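(* Consider a complete homogeneous network (with all link capacities equal to $1$) with node arrival rates $\lambda_u\ge 0$, $u\in V$, under the Oldest-Useful discipline. Then: (i) The process $X(t)$ is stable if $\lambda_u<1$ for all nodes $u\in V$. (ii) If, in addition, the network is symmetric, i.e. $\lambda_u=\lambda$ for all nodes $u\in V$, then $X(t)$ is stable if and only if $\lambda<1$.
   Context: Network model. $V$ is a finite set of $N\ge2$ nodes. The network is complete homogeneous: its links are all ordered pairs $(u,v)$ with $u\ne v$, and every link has capacity $1$. At each node $u$ new packets are created (arrive exogenously) according to a Poisson process of rate $\lambda_u\ge0$; $u$ is the source of these packets. For each link $(u,v)$ there is a Poisson process of rate $1$ of communication epochs; at each such epoch node $u$ may instantly transmit a copy of one packet to node $v$ (keeping its own copy). All these Poisson processes are mutually independent. A packet leaves the network as soon as it is available at all nodes. A packet is useful on link $(u,v)$ at a given time if it is available at $u$ but not at $v$ (it need not have source $u$). Oldest-Useful discipline: at each communication epoch of link $(u,v)$, the oldest (earliest exogenously arrived) packet among those currently useful on $(u,v)$ is transmitted; if there is none, nothing happens. State and stability. The packets present are labelled $1,\dots,k$ in order of exogenous arrival (1 is the oldest), labels being decremented when an older packet leaves. $X(t)=(x_{uv}(t))_{(u,v)}$, where $x_{uv}(t)$ is the set of (labels of) present packets with source $u$ which are not available at $v$ at time $t$. $X(\cdot)$ is a continuous-time Markov chain on the countable set of states reachable from the empty state; it is called stable if it is positive recurrent (equivalently, has a stationary distribution). *)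

theory Defs
  imports "HOL-Probability.Probability"
begin

text \<open>
  The set of nodes is a finite type. A state \<open>x\<close> assigns to nodes \<open>u\<close>, \<open>v\<close> the set \<open>x u v\<close> of
  labels of the present packets with source \<open>u\<close> that are not available at \<open>v\<close>; label \<open>1\<close> is the
  oldest packet. A present packet is missing at some node, so the labels of all present packets
  and their sources can be read off from \<open>x\<close>.
\<close>

type_synonym 'v state = "'v \<Rightarrow> 'v \<Rightarrow> nat set"

definition empty_state :: "'v state" where
  "empty_state = (\<lambda>u v. {})"

definition present :: "'v state \<Rightarrow> nat set" where
  "present x = (\<Union>u v. x u v)"

text \<open>Only the source of packet \<open>k\<close> contributes to the quantifier over \<open>s\<close>.\<close>

definition available :: "'v state \<Rightarrow> nat \<Rightarrow> 'v \<Rightarrow> bool" where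
  "available x k w \<longleftrightarrow> k \<in> present x \<and> (\<forall>s. k \<notin> x s w)"

definition useful :: "'v state \<Rightarrow> 'v \<Rightarrow> 'v \<Rightarrow> nat set" where
  "useful x u v = {k \<in> present x. available x k u \<and> \<not> available x k v}"

text \<open>The present packets have the labels \<open>1, \<dots>, k\<close>, so a new packet gets the label \<open>k + 1\<close>.\<close>

definition arrive :: "'v \<Rightarrow> 'v state \<Rightarrow> 'v state" where
  "arrive u x =
     (\<lambda>a b. if a = u \<and> b \<noteq> u then insert (card (present x) + 1) (x a b) else x a b)"

definition deliver :: "nat \<Rightarrow> 'v \<Rightarrow> 'v state \<Rightarrow> 'v state" where
  "deliver k v x = (\<lambda>a b. if b = v then x a b - {k} else x a b)"

text \<open>Packet \<open>k\<close> leaves as soon as it is missing nowhere; labels of younger packets then drop by 1.\<close>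

definition release :: "nat \<Rightarrow> 'v state \<Rightarrow> 'v state" where
  "release k x =
     (if k \<in> present x then x else (\<lambda>a b. (\<lambda>j. if k < j then j - 1 else j) ` x a b))"

text \<open>The Oldest-Useful discipline at a communication epoch of the link \<open>(u, v)\<close>.\<close>

definition communicate :: "'v \<Rightarrow> 'v \<Rightarrow> 'v state \<Rightarrow> 'v state" where
  "communicate u v x =
     (if useful x u v = {} then x
      else (let k = Min (useful x u v) in release k (deliver k v x)))"

text \<open>
  Events: \<open>Inl u\<close> is an exogenous arrival at \<open>u\<close>, \<open>Inr (u, v)\<close> is a communication epoch of the
  link \<open>(u, v)\<close>. Pairs \<open>(u, u)\<close> are not links; they get rate \<open>0\<close>.
\<close>

type_synonym 'v event = "'v + 'v \<times> 'v"

definition act :: "'v event \<Rightarrow> 'v state \<Rightarrow> 'v state" where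
  "act e x = (case e of Inl u \<Rightarrow> arrive u x | Inr (u, v) \<Rightarrow> communicate u v x)"

definition rate :: "('v \<Rightarrow> real) \<Rightarrow> 'v event \<Rightarrow> real" where
  "rate lam e = (case e of Inl u \<Rightarrow> lam u | Inr (u, v) \<Rightarrow> if u = v then 0 else 1)"

definition total_rate :: "('v::finite \<Rightarrow> real) \<Rightarrow> real" where
  "total_rate lam = (\<Sum>e\<in>UNIV. rate lam e)"

text \<open>
  The mutually independent Poisson processes of all arrivals and communication epochs are realised
  on one probability space by their superposition: a Poisson process of rate \<open>total_rate lam\<close>
  (with independent exponential gaps) whose points carry independent marks, a point being of kind
  \<open>e\<close> with probability \<open>rate lam e / total_rate lam\<close>. The points with mark \<open>e\<close> then form a Poisson
  process of rate \<open>rate lam e\<close>, and these processes are independent for different \<open>e\<close>.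
\<close>

definition mark_pmf :: "('v::finite \<Rightarrow> real) \<Rightarrow> 'v event pmf" where
  "mark_pmf lam = embed_pmf (\<lambda>e. rate lam e / total_rate lam)"

definition clock_space ::
    "('v::finite \<Rightarrow> real) \<Rightarrow> (real stream \<times> 'v event stream) measure" where
  "clock_space lam =
     stream_space (density lborel (exponential_density (total_rate lam)))
       \<Otimes>\<^sub>M stream_space (measure_pmf (mark_pmf lam))"

definition epoch :: "real stream \<Rightarrow> nat \<Rightarrow> real" where
  "epoch g n = (\<Sum>i\<le>n. g !! i)"

text \<open>The set below is finite for almost every sequence \<open>g\<close> of gaps.\<close>

definition epochs_until :: "real stream \<Rightarrow> real \<Rightarrow> nat" where
  "epochs_until g t = card {n. epoch g n \<le> t}"

text \<open>The process \<open>X(t)\<close>, started in the state \<open>x\<close>.\<close>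

definition X_path :: "'v state \<Rightarrow> real stream \<times> 'v event stream \<Rightarrow> real \<Rightarrow> 'v state" where
  "X_path x \<omega> t = fold act (stake (epochs_until (fst \<omega>) t) (snd \<omega>)) x"

inductive_set reachable :: "('v \<Rightarrow> real) \<Rightarrow> 'v state set" for lam :: "'v \<Rightarrow> real" where
  empty: "empty_state \<in> reachable lam"
| step: "x \<in> reachable lam \<Longrightarrow> 0 < rate lam e \<Longrightarrow> act e x \<in> reachable lam"

text \<open>First time at which the process is in \<open>x\<close> again after having left it; \<open>\<infinity>\<close> if there is none.\<close>

definition return_time :: "'v state \<Rightarrow> real stream \<times> 'v event stream \<Rightarrow> ennreal" where
  "return_time x \<omega> =
     (INF t\<in>{t. 0 \<le> t \<and> X_path x \<omega> t = x \<and> (\<exists>s. 0 \<le> s \<and> s < t \<and> X_path x \<omega> s \<noteq> x)}. ennreal t)"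

definition absorbing :: "('v \<Rightarrow> real) \<Rightarrow> 'v state \<Rightarrow> bool" where
  "absorbing lam x \<longleftrightarrow> (\<forall>e. 0 < rate lam e \<longrightarrow> act e x = x)"

text \<open>
  As usual in continuous time, an absorbing state counts as positive recurrent. This only matters
  if all arrival rates vanish, when the empty state is the only reachable one.
\<close>

definition positive_recurrent :: "('v::finite \<Rightarrow> real) \<Rightarrow> 'v state \<Rightarrow> bool" where
  "positive_recurrent lam x \<longleftrightarrow>
     absorbing lam x \<or> (\<integral>\<^sup>+\<omega>. return_time x \<omega> \<partial>clock_space lam) < \<infinity>"

definition stable_network :: "('v::finite \<Rightarrow> real) \<Rightarrow> bool" where
  "stable_network lam \<longleftrightarrow> (\<forall>x\<in>reachable lam. positive_recurrent lam x)"

lemma rate_nonneg: "(\<And>u. 0 \<le> lam u) \<Longrightarrow> 0 \<le> rate lam e"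
  by (auto simp: rate_def split: sum.split)

lemma total_rate_pos:
  fixes lam :: "'v::finite \<Rightarrow> real"
  assumes "2 \<le> CARD('v)" and "\<And>u. 0 \<le> lam u"
  shows "0 < total_rate lam"
proof -
  obtain u v :: 'v where "u \<noteq> v"
    using assms(1) by (metis (full_types) UNIV_I card_2_iff' ex_card)
  then have "rate lam (Inr (u, v)) = 1"
    by (simp add: rate_def)
  then show ?thesis
    unfolding total_rate_def
    by (intro sum_pos2[where i = "Inr (u, v)"]) (auto intro: rate_nonneg assms)
qed

lemma pmf_mark_pmf:
  fixes lam :: "'v::finite \<Rightarrow> real"
  assumes "2 \<le> CARD('v)" and "\<And>u. 0 \<le> lam u"
  shows "pmf (mark_pmf lam) e = rate lam e / total_rate lam"
  unfolding mark_pmf_def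
proof (rule pmf_embed_pmf)
  have pos: "0 < total_rate lam"
    by (intro total_rate_pos assms)
  show nn: "0 \<le> rate lam e / total_rate lam" for e
    using pos rate_nonneg[of lam e] assms(2) by simp
  have "(\<Sum>e\<in>UNIV. rate lam e / total_rate lam) = 1"
    using pos by (simp add: total_rate_def flip: sum_divide_distrib)
  then show "(\<integral>\<^sup>+e. ennreal (rate lam e / total_rate lam) \<partial>count_space UNIV) = 1"
    using nn by (simp add: nn_integral_count_space_finite sum_ennreal)
qed

lemma prob_space_clock_space:
  fixes lam :: "'v::finite \<Rightarrow> real"
  assumes "2 \<le> CARD('v)" and "\<And>u. 0 \<le> lam u"
  shows "prob_space (clock_space lam)"
  unfolding clock_space_def
  by (intro prob_space_pair prob_space.prob_space_stream_space
      prob_space_exponential_density total_rate_pos assms prob_space_measure_pmf)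

end

theory Submission imports Defs begin

text \<open>
  Sum the ages of all packets over the nodes \<open>v\<close> where they are missing, time being counted in
  events. Per event this grows by the backlog (the number of missing copies), and it drops by
  the age of a delivered packet. A server \<open>(u, v)\<close> holds all source-\<open>u\<close> packets missing at \<open>v\<close>, so
  under Oldest-Useful it delivers a packet at least as old as the oldest of them. If \<open>q\<close> source-\<open>u\<close>
  packets are missing at \<open>v\<close> and the oldest has age \<open>A\<close>, then \<open>q\<close> is at most the number of arrivals
  at \<open>u\<close> in the last \<open>A\<close> events, hence \<open>q \<le> r A + z\<^sub>u\<close> for a rate \<open>r\<close> between the arrival rate and
  the link rate and the workload \<open>z\<^sub>u\<close> of a stable single-server queue. Adding a multiple of
  \<open>\<Sum>z\<^sub>u\<^sup>2\<close> gives a function whose drift is at most \<open>C - \<epsilon> \<cdot> backlog\<close>. So the mean backlog of the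
  chain started empty is bounded in the Cesaro sense; from a bounded backlog each reachable state is
  reached in boundedly many steps with a probability bounded below, and the decomposition at the last
  visit turns the resulting positive frequency of visits into a finite mean return time.

  If all rates are equal to some \<open>l \<ge> 1\<close>, the backlog is a submartingale with bounded increments. It
  vanishes at the return to the empty state, so the probability of no return within \<open>m\<close> events is at
  least of order \<open>1 / m\<close>, which is not summable.
\<close>

section \<open>Means over independent events\<close>

text \<open>Expectation over \<open>n\<close> independent events with weights \<open>w\<close>, kept
  as a finite sum. \<open>nn_integral_stake\<close> later identifies it with an integral over the
  marks.\<close>

primrec mean :: "('e::finite \<Rightarrow> real) \<Rightarrow> nat \<Rightarrow> ('e list \<Rightarrow> real) \<Rightarrow> real" where
  "mean w 0 f = f []"
| "mean w (Suc n) f = (\<Sum>e\<in>UNIV. w e * mean w n (\<lambda>es. f (e # es)))"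

lemma mean_cong:
  "(\<And>es. length es = n \<Longrightarrow> f es = g es) \<Longrightarrow> mean w n f = mean w n g"
proof (induction n arbitrary: f g)
  case (Suc n)
  have "mean w n (\<lambda>es. f (e # es)) = mean w n (\<lambda>es. g (e # es))" for e
    by (rule Suc.IH) (simp add: Suc.prems)
  then show ?case by simp
qed simp

text \<open>The recursion of \<open>mean\<close> splits off the first event, whereas drift
  conditions speak of the last one.\<close>

lemma mean_snoc: "mean w (Suc n) f = mean w n (\<lambda>es. \<Sum>e\<in>UNIV. w e * f (es @ [e]))"
proof (induction n arbitrary: f)
  case (Suc n)
  show ?case
    by (subst mean.simps(2), subst Suc.IH) simp
qed simp

lemma mean_append: "mean w (m + n) f = mean w m (\<lambda>es. mean w n (\<lambda>fs. f (es @ fs)))"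
  by (induction m arbitrary: f) simp_all

lemma mean_add: "mean w n (\<lambda>es. f es + g es) = mean w n f + mean w n g"
  by (induction n arbitrary: f g) (simp_all add: distrib_left sum.distrib)

lemma mean_cmult: "mean w n (\<lambda>es. c * f es) = c * mean w n f"
  by (induction n arbitrary: f) (simp_all add: sum_distrib_left mult.left_commute)

lemma mean_cmult_right: "mean w n (\<lambda>es. f es * c) = mean w n f * c"
  using mean_cmult[of w n c f] by (simp add: mult.commute)

lemma mean_diff: "mean w n (\<lambda>es. f es - g es) = mean w n f - mean w n g"
  by (induction n arbitrary: f g) (simp_all add: right_diff_distrib sum_subtractf)

lemma mean_sum: "mean w n (\<lambda>es. \<Sum>i\<in>I. f i es) = (\<Sum>i\<in>I. mean w n (f i))"
proof (induction n arbitrary: f)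
  case (Suc n)
  show ?case
    by (simp add: Suc.IH sum_distrib_left) (rule sum.swap)
qed simp

locale event_weights =
  fixes w :: "'e::finite \<Rightarrow> real"
  assumes w_nonneg: "0 \<le> w e" and w_sum: "(\<Sum>e\<in>UNIV. w e) = 1"
begin

lemma mean_mono:
  "(\<And>es. length es = n \<Longrightarrow> f es \<le> g es) \<Longrightarrow> mean w n f \<le> mean w n g"
proof (induction n arbitrary: f g)
  case (Suc n)
  have "mean w n (\<lambda>es. f (e # es)) \<le> mean w n (\<lambda>es. g (e # es))" for e
    by (rule Suc.IH) (simp add: Suc.prems)
  then show ?case by (simp add: sum_mono mult_left_mono w_nonneg)
qed simp

lemma mean_const: "mean w n (\<lambda>es. c) = c"
  by (induction n) (simp_all add: w_sum flip: sum_distrib_right)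

lemma mean_nonneg: "(\<And>es. 0 \<le> f es) \<Longrightarrow> 0 \<le> mean w n f"
  using mean_mono[of n "\<lambda>_. 0" f] by (simp add: mean_const)

text \<open>Serves to bound a probability from below by the weight of one favourable path.\<close>

lemma mean_ge_path:
  assumes "\<And>es. 0 \<le> f es"
  shows "prod_list (map w fs) * f fs \<le> mean w (length fs) f"
  using assms
proof (induction fs arbitrary: f)
  case (Cons e fs)
  have "prod_list (map w (e # fs)) * f (e # fs)
      \<le> w e * mean w (length fs) (\<lambda>es. f (e # es))"
    using Cons.IH[of "\<lambda>es. f (e # es)"] Cons.prems w_nonneg[of e]
    by (simp add: mult.assoc mult_left_mono)
  also have "\<dots> \<le> mean w (length (e # fs)) f"
    using member_le_sum[of e UNIV "\<lambda>e. w e * mean w (length fs) (\<lambda>es. f (e # es))"]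
    by (simp add: w_nonneg mean_nonneg Cons.prems)
  finally show ?case .
qed simp

text \<open>Foster-Lyapunov argument by telescoping. \<open>L\<close> takes the whole history, since
  the function used later is not determined by the network state alone.\<close>

lemma sum_mean_drift:
  assumes drift: "\<And>es. (\<Sum>e\<in>UNIV. w e * L (es @ [e])) \<le> L es + c - d * F es"
    and nonneg: "\<And>es. 0 \<le> L es"
  shows "d * (\<Sum>n<T. mean w n F) \<le> L [] + c * real T"
proof -
  \<comment> \<open>The mean of \<open>L\<close> stays on the left so that the induction closes;
    nonnegativity discards it afterwards.\<close>
  have "mean w T L + d * (\<Sum>n<T. mean w n F) \<le> L [] + c * real T"
  proof (induction T)
    case (Suc T)
    have "mean w (Suc T) L \<le> mean w T (\<lambda>es. L es + c - d * F es)"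
      unfolding mean_snoc by (intro mean_mono drift)
    also have "\<dots> = mean w T L + c - d * mean w T F"
      by (simp add: mean_add mean_diff mean_cmult mean_const)
    finally show ?case
      using Suc by (simp add: algebra_simps)
  qed simp
  then show ?thesis
    using mean_nonneg[of L T, OF nonneg] by linarith
qed

end

section \<open>States and their backlog\<close>

lemma act_simps [simp]: "act (Inl u) x = arrive u x" "act (Inr (u, v)) x = communicate u v x"
  by (simp_all add: act_def)

text \<open>Invariant of runs from the empty state. A state lists only missing copies, so uniqueness
  of the source has to be demanded for a label to denote one packet.\<close>

definition consistent :: "'v state \<Rightarrow> bool" where
  "consistent x \<longleftrightarrow> (\<exists>K. present x = {1..K}) \<and> (\<forall>u. x u u = {}) \<and>
     (\<forall>k u v u' v'. k \<in> x u v \<longrightarrow> k \<in> x u' v' \<longrightarrow> u = u')"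

lemma in_present: "k \<in> x u v \<Longrightarrow> k \<in> present x"
  by (auto simp: present_def)

lemma consistentE:
  assumes "consistent x"
  obtains K where "present x = {1..K}"
  using assms by (auto simp: consistent_def)

lemma consistent_self: "consistent x \<Longrightarrow> x u u = {}"
  by (auto simp: consistent_def)

lemma source_unique: "consistent x \<Longrightarrow> k \<in> x u v \<Longrightarrow> k \<in> x u' v' \<Longrightarrow> u = u'"
  unfolding consistent_def by blast

lemma new_label_notin: "consistent x \<Longrightarrow> Suc (card (present x)) \<notin> x a b"
  by (metis Suc_n_not_le_n atLeastAtMost_iff card_atLeastAtMost consistentE diff_Suc_1 in_present
      minus_nat.diff_0 diff_Suc_Suc One_nat_def)

section \<open>Relabelling after a departure\<close>

definition shift_down :: "nat \<Rightarrow> nat \<Rightarrow> nat" where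
  "shift_down k j = (if k < j then j - 1 else j)"

text \<open>\<open>shift_down k\<close> is the relabelling of \<open>release\<close>;
  \<open>shift_up k\<close> inverts it off the gap \<open>k\<close>, which turns images of label
  sets into preimages.\<close>

definition shift_up :: "nat \<Rightarrow> nat \<Rightarrow> nat" where
  "shift_up k j = (if j < k then j else Suc j)"

lemma shift_up_down: "j \<noteq> k \<Longrightarrow> shift_up k (shift_down k j) = j"
  by (auto simp: shift_up_def shift_down_def)

lemma shift_down_up: "shift_down k (shift_up k j) = j"
  by (auto simp: shift_up_def shift_down_def)

lemma shift_up_mono: "i \<le> j \<Longrightarrow> shift_up k i \<le> shift_up k j"
  by (auto simp: shift_up_def)

lemma shift_down_image: "k \<notin> A \<Longrightarrow> shift_down k ` A = {j. shift_up k j \<in> A}"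
proof (intro set_eqI iffI)
  fix j assume "k \<notin> A" "j \<in> shift_down k ` A"
  then obtain i where "i \<in> A" "j = shift_down k i" by blast
  then show "j \<in> {j. shift_up k j \<in> A}"
    using \<open>k \<notin> A\<close> by (metis mem_Collect_eq shift_up_down)
next
  fix j assume "j \<in> {j. shift_up k j \<in> A}"
  then show "j \<in> shift_down k ` A"
    by (metis image_eqI mem_Collect_eq shift_down_up)
qed

lemma inj_on_shift_down: "k \<notin> A \<Longrightarrow> inj_on (shift_down k) A"
  by (metis inj_onI shift_up_down)

lemma release_eq:
  "release k x = (if k \<in> present x then x else (\<lambda>a b. shift_down k ` x a b))"
  by (simp add: release_def shift_down_def)

text \<open>A packet is recorded only where it is missing, so a second node is needed for the new
  label to show up.\<close>

lemma present_arrive: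
  fixes u :: "'v::finite"
  assumes "2 \<le> CARD('v)"
  shows "present (arrive u x) = insert (card (present x) + 1) (present x)"
proof -
  obtain v where "v \<noteq> u"
    using assms by (metis One_nat_def UNIV_I card_2_iff' ex_card)
  then have "Suc (card (present x)) \<in> arrive u x u v"
    by (simp add: arrive_def)
  then have "Suc (card (present x)) \<in> present (arrive u x)"
    by (rule in_present)
  moreover have "x a b \<subseteq> arrive u x a b" "arrive u x a b \<subseteq> insert (Suc (card (present x))) (x a b)" for a b
    by (auto simp: arrive_def)
  ultimately show ?thesis
    unfolding present_def by (auto, blast+)
qed

lemma consistent_empty: "consistent empty_state"
  by (auto simp: consistent_def empty_state_def present_def intro: exI[of _ 0])

lemma consistent_arrive:
  fixes u :: "'v::finite"
  assumes "2 \<le> CARD('v)" and x: "consistent x"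
  shows "consistent (arrive u x)"
proof -
  obtain K where K: "present x = {1..K}"
    using x by (rule consistentE)
  have "present (arrive u x) = {1..Suc K}"
    using K by (auto simp: present_arrive[OF assms(1)])
  moreover have "arrive u x a a = {}" for a
    using x by (auto simp: arrive_def consistent_self)
  moreover have "a = a'" if "k \<in> arrive u x a b" "k \<in> arrive u x a' b'" for k a b a' b'
    using that new_label_notin[OF x] source_unique[OF x]
    by (auto simp: arrive_def split: if_splits)
  ultimately show ?thesis
    unfolding consistent_def by blast
qed

lemma finite_present: "consistent x \<Longrightarrow> finite (present x)"
  by (auto simp: consistent_def)

lemma finite_missing: "consistent x \<Longrightarrow> finite (x u v)"
  by (rule finite_subset[OF _ finite_present]) (auto simp: present_def)

lemma finite_useful: "consistent x \<Longrightarrow> finite (useful x u v)"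
  by (rule finite_subset[OF _ finite_present]) (auto simp: useful_def)

text \<open>The source of a packet holds it: the label has the single source \<open>u\<close>, and
  \<open>x u u\<close> is empty.\<close>

lemma missing_subset_useful:
  assumes "consistent x"
  shows "x u v \<subseteq> useful x u v"
proof
  fix k assume k: "k \<in> x u v"
  have "k \<notin> x s u" for s
    using source_unique[OF assms k] consistent_self[OF assms] by blast
  then show "k \<in> useful x u v"
    using k in_present[of k x u v] by (auto simp: useful_def available_def)
qed

text \<open>If other nodes still miss the packet, the label set is unchanged; otherwise
  \<open>k\<close> becomes a gap in \<open>{1..K}\<close>, which the relabelling closes.\<close>

lemma consistent_deliver_release:
  assumes x: "consistent x" and k: "k \<in> present x"
  shows "consistent (release k (deliver k v x))"
proof -
  obtain K where K: "present x = {1..K}"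
    using x by (auto simp: consistent_def)
  let ?d = "deliver k v x"
  have sub: "?d a b \<subseteq> x a b" for a b
    by (auto simp: deliver_def)
  have pd: "present ?d \<subseteq> present x" "present x - {k} \<subseteq> present ?d"
    by (fastforce simp: present_def deliver_def)+
  show ?thesis
  proof (cases "k \<in> present ?d")
    case True
    then have "present ?d = present x" using pd by auto
    then show ?thesis
      using True sub K consistent_self[OF x] source_unique[OF x]
      unfolding consistent_def release_eq by (simp, blast)
  next
    case False
    then have p: "present ?d = {1..K} - {k}" using pd K by auto
    have im: "release k ?d a b = {j. shift_up k j \<in> ?d a b}" for a b
    proof -
      have "k \<notin> ?d a b" using False by (auto simp: present_def)
      then show ?thesis using False by (simp add: release_eq shift_down_image)
    qed
    have "present (release k ?d) = {j. shift_up k j \<in> present ?d}"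
      unfolding present_def im by auto
    also have "\<dots> = {1..K-1}"
      using k K by (auto simp: p shift_up_def split: if_splits)
    finally have "present (release k ?d) = {1..K-1}" .
    moreover have "release k ?d a a = {}" for a
      using sub[of a a] consistent_self[OF x, of a] by (simp add: im)
    moreover have "a = a'" if "j \<in> release k ?d a b" "j \<in> release k ?d a' b'" for j a b a' b'
      using that sub source_unique[OF x] unfolding im by blast
    ultimately show ?thesis
      unfolding consistent_def by blast
  qed
qed

lemma Min_useful_in: "consistent x \<Longrightarrow> useful x u v \<noteq> {} \<Longrightarrow> Min (useful x u v) \<in> useful x u v"
  by (simp add: finite_useful)

lemma consistent_communicate:
  assumes "consistent x"
  shows "consistent (communicate u v x)"
proof (cases "useful x u v = {}")
  case False
  then have "Min (useful x u v) \<in> present x"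
    using Min_useful_in[OF assms False] by (auto simp: useful_def)
  then show ?thesis
    using assms False by (simp add: communicate_def Let_def consistent_deliver_release)
qed (simp add: communicate_def assms)

lemma consistent_act:
  fixes x :: "'v::finite state"
  assumes "2 \<le> CARD('v)" and "consistent x"
  shows "consistent (act e x)"
  using assms by (auto simp: act_def consistent_arrive consistent_communicate split: sum.split)

lemma consistent_run:
  fixes x :: "'v::finite state"
  assumes "2 \<le> CARD('v)" and "consistent x"
  shows "consistent (fold act es x)"
  using assms(2) by (induction es arbitrary: x) (auto simp: consistent_act[OF assms(1)])

section \<open>Backlog and weighted sums over missing copies\<close>

definition backlog :: "'v::finite state \<Rightarrow> nat" where
  "backlog x = (\<Sum>u\<in>UNIV. \<Sum>v\<in>UNIV. card (x u v))"

lemma backlog_empty: "backlog empty_state = 0"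
  by (simp add: backlog_def empty_state_def)

lemma backlog_eq_0: "consistent x \<Longrightarrow> backlog x = 0 \<longleftrightarrow> x = empty_state"
  by (simp add: backlog_def empty_state_def fun_eq_iff finite_missing)

text \<open>Ages as weights \<open>f\<close> give the Lyapunov function, \<open>f = 1\<close> gives the backlog.\<close>

definition label_sum :: "'v::finite state \<Rightarrow> (nat \<Rightarrow> real) \<Rightarrow> real" where
  "label_sum x f = (\<Sum>u\<in>UNIV. \<Sum>v\<in>UNIV. \<Sum>k\<in>x u v. f k)"

lemma label_sum_1: "label_sum x (\<lambda>_. 1) = real (backlog x)"
  by (simp add: label_sum_def backlog_def)

lemma label_sum_add: "label_sum x (\<lambda>k. f k + g k) = label_sum x f + label_sum x g"
  by (simp add: label_sum_def sum.distrib)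

lemma label_sum_arrive:
  fixes x :: "'v::finite state"
  assumes "2 \<le> CARD('v)" and x: "consistent x"
  shows "label_sum (arrive u x) f = label_sum x f + (real CARD('v) - 1) * f (card (present x) + 1)"
proof -
  let ?K = "card (present x) + 1"
  have s: "(\<Sum>k\<in>arrive u x a b. f k) = (\<Sum>k\<in>x a b. f k) + (if a = u then if b \<noteq> u then f ?K else 0 else 0)" for a b
    using finite_missing[OF x] new_label_notin[OF x] by (auto simp: arrive_def)
  have "(\<Sum>a\<in>UNIV. \<Sum>b\<in>UNIV. if a = u then if b \<noteq> u then f ?K else 0 else 0)
      = (\<Sum>a\<in>UNIV. if a = u then (\<Sum>b\<in>UNIV. if b \<noteq> u then f ?K else 0) else 0)"
    by (intro sum.cong) auto
  also have "\<dots> = (\<Sum>b\<in>UNIV - {u}. f ?K)"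
    by (simp add: sum.If_cases Compl_eq_Diff_UNIV set_diff_eq)
  also have "\<dots> = (real CARD('v) - 1) * f ?K"
    using assms(1) by (simp add: card_Diff_singleton of_nat_diff)
  finally show ?thesis
    by (simp add: label_sum_def s sum.distrib)
qed

text \<open>The source of \<open>k\<close> is unique, so exactly one of the sets
  \<open>x a v\<close> loses \<open>k\<close>.\<close>

lemma label_sum_deliver:
  assumes x: "consistent x" and k: "k \<in> x s v"
  shows "label_sum (deliver k v x) f = label_sum x f - f k"
proof -
  have "k \<in> x a v \<longleftrightarrow> a = s" for a
    using k source_unique[OF x k] by blast
  then have s: "(\<Sum>j\<in>deliver k v x a b. f j) = (\<Sum>j\<in>x a b. f j) - (if a = s then if b = v then f k else 0 else 0)" for a b
    using finite_missing[OF x] by (auto simp: deliver_def sum_diff1)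
  have "(\<Sum>a\<in>UNIV. \<Sum>b\<in>UNIV. if a = s then if b = v then f k else 0 else 0)
      = (\<Sum>a\<in>UNIV. if a = s then (\<Sum>b\<in>UNIV. if b = v then f k else 0) else 0)"
    by (intro sum.cong) auto
  then show ?thesis
    by (simp add: label_sum_def s sum_subtractf)
qed

lemma label_sum_relabel:
  assumes "k \<notin> present x"
  shows "label_sum (release k x) f = label_sum x (\<lambda>j. f (shift_down k j))"
proof -
  have "k \<notin> x a b" for a b using assms by (auto simp: present_def)
  then have "(\<Sum>j\<in>shift_down k ` x a b. f j) = (\<Sum>j\<in>x a b. f (shift_down k j))" for a b
    by (subst sum.reindex) (auto simp: inj_on_shift_down)
  then show ?thesis using assms by (simp add: label_sum_def release_eq)
qed

lemma label_sum_cong: "(\<And>k. k \<in> present x \<Longrightarrow> f k = g k) \<Longrightarrow> label_sum x f = label_sum x g"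
  unfolding label_sum_def by (intro sum.cong) (auto simp: present_def)

lemma label_sum_release_const: "label_sum (release k x) (\<lambda>_. c) = label_sum x (\<lambda>_. c)"
  by (cases "k \<in> present x") (simp_all add: label_sum_relabel, simp add: release_eq)

lemma backlog_arrive:
  fixes x :: "'v::finite state"
  assumes "2 \<le> CARD('v)" and x: "consistent x"
  shows "real (backlog (arrive u x)) = real (backlog x) + (real CARD('v) - 1)"
  using label_sum_arrive[OF assms, of u "\<lambda>_. 1"] by (simp add: label_sum_1)

lemma Min_useful_missing:
  assumes "consistent x" "useful x u v \<noteq> {}"
  obtains s where "Min (useful x u v) \<in> x s v"
  using Min_useful_in[OF assms] by (auto simp: useful_def available_def)

lemma backlog_communicate:
  assumes x: "consistent x"
  shows "real (backlog (communicate u v x)) = real (backlog x) - (if useful x u v = {} then 0 else 1)"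
proof (cases "useful x u v = {}")
  case False
  let ?k = "Min (useful x u v)"
  obtain s where "?k \<in> x s v" using Min_useful_missing[OF x False] .
  then show ?thesis
    using False label_sum_deliver[OF x, of ?k s v "\<lambda>_. 1"]
    by (simp add: communicate_def Let_def label_sum_release_const flip: label_sum_1)
qed (simp add: communicate_def)

lemma exists_useful:
  assumes x: "consistent x" and "x \<noteq> empty_state"
  obtains u v where "u \<noteq> v" "useful x u v \<noteq> {}"
proof -
  obtain u v k where "k \<in> x u v"
    using assms(2) by (fastforce simp: empty_state_def fun_eq_iff)
  moreover have "u \<noteq> v"
    using \<open>k \<in> x u v\<close> x by (auto simp: consistent_def)
  ultimately show ?thesis
    using missing_subset_useful[OF x, of u v] that by blast
qed

text \<open>Communications have no effect in the empty network, so the length of the run can be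
  prescribed.\<close>

lemma drain:
  fixes x :: "'v::finite state"
  assumes "2 \<le> CARD('v)" and "consistent x" and "backlog x \<le> m"
  shows "\<exists>fs. length fs = m \<and> (\<forall>e\<in>set fs. \<exists>u v. e = Inr (u, v) \<and> u \<noteq> v) \<and> fold act fs x = empty_state"
  using assms(2,3)
proof (induction m arbitrary: x)
  case 0
  then show ?case by (simp add: backlog_eq_0)
next
  case (Suc m)
  have "\<exists>u v. u \<noteq> v \<and> backlog (communicate u v x) \<le> m"
  proof (cases "x = empty_state")
    case True
    obtain u v :: 'v where "u \<noteq> v"
      using assms(1) by (metis (full_types) UNIV_I card_2_iff' ex_card)
    moreover have "useful empty_state u v = {}"
      by (simp add: useful_def present_def empty_state_def)
    ultimately have "backlog (communicate u v x) \<le> m"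
      using True by (simp add: communicate_def backlog_empty)
    with \<open>u \<noteq> v\<close> show ?thesis by blast
  next
    case False
    then obtain u v where "u \<noteq> v" "useful x u v \<noteq> {}"
      using exists_useful Suc.prems by blast
    then have "backlog (communicate u v x) \<le> m"
      using backlog_communicate[of x u v] Suc.prems by auto
    with \<open>u \<noteq> v\<close> show ?thesis by blast
  qed
  then obtain u v where uv: "u \<noteq> v" "backlog (communicate u v x) \<le> m" by blast
  obtain fs where "length fs = m" "\<forall>e\<in>set fs. \<exists>u v. e = Inr (u, v) \<and> u \<noteq> v"
      "fold act fs (communicate u v x) = empty_state"
    using Suc.IH[OF consistent_communicate[OF Suc.prems(1)] uv(2)] by blast
  then show ?case
    using uv(1) by (intro exI[of _ "Inr (u, v) # fs"]) auto
qed

section \<open>The Lyapunov function\<close>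

text \<open>States do not record arrival times, so ages are carried along with the labels.\<close>

definition age_step :: "'v event \<Rightarrow> 'v state \<Rightarrow> (nat \<Rightarrow> real) \<Rightarrow> nat \<Rightarrow> real" where
  "age_step e x a = (case e of
       Inl u \<Rightarrow> (\<lambda>k. if k = card (present x) + 1 then 1 else a k + 1)
     | Inr (u, v) \<Rightarrow>
         (let k = Min (useful x u v) in
          if useful x u v = {} \<or> k \<in> present (deliver k v x) then (\<lambda>j. a j + 1)
          else (\<lambda>j. a (shift_up k j) + 1)))"

text \<open>Lindley's recursion: \<open>z u\<close> is the maximum over \<open>m \<ge> 0\<close> of the number of arrivals at \<open>u\<close> among the
  last \<open>m\<close> events, minus \<open>r m\<close>.\<close>

definition excess_step :: "real \<Rightarrow> 'v event \<Rightarrow> ('v \<Rightarrow> real) \<Rightarrow> 'v \<Rightarrow> real" where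
  "excess_step r e z = (\<lambda>u. max 0 (z u + (if e = Inl u then 1 else 0) - r))"

definition step :: "real \<Rightarrow> 'v event \<Rightarrow> 'v state \<times> (nat \<Rightarrow> real) \<times> ('v \<Rightarrow> real) \<Rightarrow>
    'v state \<times> (nat \<Rightarrow> real) \<times> ('v \<Rightarrow> real)" where
  "step r e = (\<lambda>(x, a, z). (act e x, age_step e x a, excess_step r e z))"

text \<open>The last condition: the number of source-\<open>u\<close> packets at least as young as \<open>k\<close> is bounded by the number of
  arrivals at \<open>u\<close> during the lifetime of \<open>k\<close>.\<close>

definition aged :: "real \<Rightarrow> 'v state \<times> (nat \<Rightarrow> real) \<times> ('v \<Rightarrow> real) \<Rightarrow> bool" where
  "aged r = (\<lambda>(x, a, z). consistent x \<and> (\<forall>u. 0 \<le> z u) \<and> (\<forall>k\<in>present x. 0 \<le> a k) \<and>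
     (\<forall>j\<in>present x. \<forall>k\<in>present x. j \<le> k \<longrightarrow> a k \<le> a j) \<and>
     (\<forall>u v. \<forall>k\<in>x u v. real (card {j \<in> x u v. k \<le> j}) \<le> r * a k + z u))"

text \<open>Ageing by one raises \<open>r * a k\<close> by \<open>r\<close>, which pays for a fall
  of \<open>z\<close> by at most \<open>r\<close>, while the counts can only drop.\<close>

lemma aged_deliver_release:
  assumes r: "0 \<le> r" and x: "aged r (x, a, z)" and k: "k \<in> present x"
    and z': "\<And>u. 0 \<le> z' u" "\<And>u. z u - r \<le> z' u"
  shows "aged r (release k (deliver k v x),
    (if k \<in> present (deliver k v x) then (\<lambda>j. a j + 1) else (\<lambda>j. a (shift_up k j) + 1)), z')"
proof -
  let ?d = "deliver k v x"
  have c: "consistent x" using x by (simp add: aged_def)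
  have sub: "j \<in> x s b" if "j \<in> ?d s b" for j s b
    using that by (auto simp: deliver_def split: if_splits)
  have pd: "j \<in> present x" if "j \<in> present ?d" for j
    using that sub unfolding present_def by blast
  have count: "real (card {j \<in> ?d s b. i \<le> j}) \<le> r * (a i + 1) + z' s" if "i \<in> ?d s b" for i s b
  proof -
    have "card {j \<in> ?d s b. i \<le> j} \<le> card {j \<in> x s b. i \<le> j}"
      using finite_missing[OF c] by (intro card_mono) (auto dest: sub)
    moreover have "real (card {j \<in> x s b. i \<le> j}) \<le> r * a i + z s"
      using x sub[OF that] by (auto simp: aged_def)
    ultimately show ?thesis
      using z'(2)[of s] by (simp add: algebra_simps)
  qed
  have c': "consistent (release k ?d)"
    by (rule consistent_deliver_release[OF c k])
  show ?thesis
  proof (cases "k \<in> present ?d")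
    case True
    then have "release k ?d = ?d" by (simp add: release_eq)
    then show ?thesis
      using True x c' count pd z' by (auto simp: aged_def)
  next
    case False
    then have "k \<notin> ?d s b" for s b by (auto simp: present_def)
    then have im: "release k ?d s b = {j. shift_up k j \<in> ?d s b}" for s b
      using False by (simp add: release_eq shift_down_image)
    have p: "shift_up k j \<in> present x" if "j \<in> present (release k ?d)" for j
      using that sub unfolding present_def im by blast
    have "real (card {j \<in> release k ?d s b. i \<le> j}) \<le> r * (a (shift_up k i) + 1) + z' s"
      if "i \<in> release k ?d s b" for i s b
    proof -
      \<comment> \<open>\<open>shift_up k\<close> embeds the relabelled young packets into those
        before the relabelling.\<close>
      have "card {j \<in> release k ?d s b. i \<le> j} \<le> card {j \<in> ?d s b. shift_up k i \<le> j}"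
      proof (rule card_inj_on_le[of "shift_up k"])
        show "inj_on (shift_up k) {j \<in> release k ?d s b. i \<le> j}"
          by (metis inj_onI shift_down_up)
        show "shift_up k ` {j \<in> release k ?d s b. i \<le> j} \<subseteq> {j \<in> ?d s b. shift_up k i \<le> j}"
          by (auto simp: im shift_up_mono)
        show "finite {j \<in> ?d s b. shift_up k i \<le> j}"
          by (rule finite_subset[OF _ finite_missing[OF c, of s b]]) (auto dest: sub)
      qed
      then show ?thesis
        using count[of "shift_up k i" s b] that by (simp add: im)
    qed
    then show ?thesis
      using False x c' p z' shift_up_mono by (simp add: aged_def)
  qed
qed

text \<open>An arrival at \<open>u\<close> raises counts of source-\<open>u\<close> packets by at
  most one; \<open>z u\<close> grows by at least \<open>1 - r\<close>, and ageing supplies the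
  remaining \<open>r\<close>.\<close>

lemma aged_step:
  fixes x :: "'v::finite state"
  assumes N: "2 \<le> CARD('v)" and r: "0 \<le> r" and x: "aged r (x, a, z)"
  shows "aged r (step r e (x, a, z))"
proof (cases e)
  case (Inl u)
  let ?K = "Suc (card (present x))" and ?z = "excess_step r e z"
  have c: "consistent x" using x by (simp add: aged_def)
  obtain K where K: "present x = {1..K}" using c by (rule consistentE)
  have K': "?K = Suc K" using K by simp
  have p: "present (arrive u x) = insert ?K (present x)"
    using present_arrive[OF N] by simp
  have le: "j \<le> K" if "j \<in> x s b" for j s b using in_present[of j x s b] that K by simp
  have new: "?K \<notin> present x" using K by simp
  have z': "0 \<le> ?z s" "z s + (if s = u then 1 else 0) - r \<le> ?z s" for s
    using Inl by (auto simp: excess_step_def)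
  have "real (card {j \<in> arrive u x s b. k \<le> j}) \<le> r * age_step e x a k + ?z s"
    if k: "k \<in> arrive u x s b" for k s b
  proof (cases "k = ?K")
    case True
    have "{j \<in> arrive u x s b. k \<le> j} \<subseteq> {?K}"
      using True le by (fastforce simp: arrive_def K' split: if_splits)
    then have "card {j \<in> arrive u x s b. k \<le> j} \<le> 1"
      using card_mono[of "{?K}"] by simp
    moreover have "s = u"
      using k True new in_present[of _ x s b] by (auto simp: arrive_def split: if_splits)
    moreover have "0 \<le> z u" using x by (simp add: aged_def)
    \<comment> \<open>The new packet has age 1, so the right side is at least
      \<open>r + (z u + 1 - r)\<close>, hence at least 1.\<close>
    ultimately show ?thesis
      using z'(2)[of u] True Inl by (simp add: age_step_def)
  next
    case False
    then have kx: "k \<in> x s b" using k by (auto simp: arrive_def split: if_splits)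
    have "{j \<in> arrive u x s b. k \<le> j} \<subseteq> {j \<in> x s b. k \<le> j} \<union> (if s = u then {?K} else {})"
      by (auto simp: arrive_def)
    then have "card {j \<in> arrive u x s b. k \<le> j} \<le> card ({j \<in> x s b. k \<le> j} \<union> (if s = u then {?K} else {}))"
      using finite_missing[OF c] by (intro card_mono) auto
    also have "\<dots> \<le> card {j \<in> x s b. k \<le> j} + (if s = u then 1 else 0)"
      by (rule order_trans[OF card_Un_le]) auto
    finally have "real (card {j \<in> arrive u x s b. k \<le> j})
        \<le> real (card {j \<in> x s b. k \<le> j}) + (if s = u then 1 else 0)"
      by (auto split: if_splits)
    moreover have "real (card {j \<in> x s b. k \<le> j}) \<le> r * a k + z s"
      using x kx by (auto simp: aged_def)
    ultimately show ?thesis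
      using z'(2)[of s] False Inl by (simp add: age_step_def algebra_simps)
  qed
  moreover have "age_step e x a k \<le> age_step e x a j"
    if "j \<in> present (arrive u x)" "k \<in> present (arrive u x)" "j \<le> k" for j k
    using that x K K' unfolding p by (auto simp: age_step_def Inl aged_def)
  moreover have "0 \<le> age_step e x a k" if "k \<in> present (arrive u x)" for k
    using that x unfolding p by (auto simp: age_step_def Inl aged_def intro: add_nonneg_nonneg)
  ultimately show ?thesis
    using z'(1) consistent_arrive[OF N c]
    unfolding aged_def step_def by (simp add: Inl)
next
  case (Inr uv)
  obtain u v where uv: "uv = (u, v)" by (cases uv)
  let ?z = "excess_step r e z"
  have z': "0 \<le> ?z s" "z s - r \<le> ?z s" for s
    using Inr by (auto simp: excess_step_def)
  have c: "consistent x" using x by (simp add: aged_def)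
  show ?thesis
  proof (cases "useful x u v = {}")
    case True
    have "real (card {j \<in> x s b. k \<le> j}) \<le> r * (a k + 1) + ?z s" if "k \<in> x s b" for k s b
      using x that z'(2)[of s] by (force simp: aged_def algebra_simps)
    then show ?thesis
      using True x z' by (auto simp: step_def Inr uv communicate_def age_step_def aged_def)
  next
    case False
    then have "Min (useful x u v) \<in> present x"
      using Min_useful_in[OF c False] by (auto simp: useful_def)
    from aged_deliver_release[OF r x this z', of v] show ?thesis
      using False by (auto simp: step_def Inr uv communicate_def age_step_def Let_def)
  qed
qed

lemma label_sum_age_nonneg: "aged r (x, a, z) \<Longrightarrow> 0 \<le> label_sum x a"
  unfolding label_sum_def by (intro sum_nonneg) (auto simp: aged_def present_def)

lemma label_sum_aging: "label_sum x (\<lambda>k. a k + 1) = label_sum x a + real (backlog x)"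
  by (simp add: label_sum_add label_sum_1)

text \<open>Each old copy ages by one, and the fewer than \<open>CARD('v)\<close> new ones have age
  1.\<close>

lemma label_sum_age_arrive:
  fixes x :: "'v::finite state"
  assumes N: "2 \<le> CARD('v)" and c: "consistent x"
  shows "label_sum (arrive u x) (age_step (Inl u) x a) \<le> label_sum x a + real (backlog x) + real CARD('v)"
proof -
  have "label_sum x (age_step (Inl u) x a) = label_sum x (\<lambda>k. a k + 1)"
    using new_label_notin[OF c] by (intro label_sum_cong) (auto simp: age_step_def present_def)
  then show ?thesis
    by (simp add: label_sum_arrive[OF N c] label_sum_aging) (simp add: age_step_def)
qed

text \<open>The server \<open>(u, v)\<close> delivers a packet at least as old as any source-\<open>u\<close> packet missing at
  \<open>v\<close>, since it holds all of these.\<close>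

lemma label_sum_age_communicate:
  fixes x :: "'v::finite state"
  assumes r: "0 < r" and x: "aged r (x, a, z)"
  shows "label_sum (communicate u v x) (age_step (Inr (u, v)) x a)
    \<le> label_sum x a + real (backlog x) - (real (card (x u v)) - z u) / r"
proof -
  have c: "consistent x" and z: "0 \<le> z u" using x by (simp_all add: aged_def)
  show ?thesis
  proof (cases "useful x u v = {}")
    case True
    moreover have "x u v = {}" using missing_subset_useful[OF c, of u v] True by simp
    ultimately show ?thesis
      using z r by (simp add: communicate_def age_step_def label_sum_aging)
  next
    case False
    let ?k = "Min (useful x u v)"
    have kp: "?k \<in> present x"
      using Min_useful_in[OF c False] by (auto simp: useful_def)
    obtain s where s: "?k \<in> x s v" using Min_useful_missing[OF c False] .
    \<comment> \<open>If the packet leaves, \<open>release\<close> shifts the labels and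
      \<open>age_step\<close> shifts the ages along, so the sum is the same as without
      relabelling.\<close>
    have "label_sum (communicate u v x) (age_step (Inr (u, v)) x a)
        = label_sum (deliver ?k v x) (\<lambda>j. a j + 1)"
    proof (cases "?k \<in> present (deliver ?k v x)")
      case True
      then show ?thesis
        using False by (simp add: communicate_def Let_def age_step_def release_eq)
    next
      case F2: False
      have "label_sum (communicate u v x) (age_step (Inr (u, v)) x a)
          = label_sum (deliver ?k v x) (\<lambda>j. a (shift_up ?k (shift_down ?k j)) + 1)"
        using False F2 by (simp add: communicate_def Let_def age_step_def label_sum_relabel)
      also have "\<dots> = label_sum (deliver ?k v x) (\<lambda>j. a j + 1)"
        using F2 by (intro label_sum_cong) (metis shift_up_down)
      finally show ?thesis .
    qed
    also have "\<dots> = label_sum x a + real (backlog x) - (a ?k + 1)"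
      unfolding label_sum_deliver[OF c s, of "\<lambda>j. a j + 1"] label_sum_aging[of x] ..
    finally have eq: "label_sum (communicate u v x) (age_step (Inr (u, v)) x a)
        = label_sum x a + real (backlog x) - (a ?k + 1)" .
    have "real (card (x u v)) - z u \<le> r * a ?k"
    proof (cases "x u v = {}")
      case True
      moreover have "0 \<le> r * a ?k" using r x kp by (simp add: aged_def)
      ultimately show ?thesis using z by simp
    next
      case ne: False
      let ?m = "Min (x u v)"
      have m: "?m \<in> x u v" using ne finite_missing[OF c] by simp
      \<comment> \<open>At the oldest packet \<open>?m\<close>, the invariant bounds the size of all
        of \<open>x u v\<close>.\<close>
      have "{j \<in> x u v. ?m \<le> j} = x u v" using finite_missing[OF c] by auto
      then have "real (card (x u v)) \<le> r * a ?m + z u"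
        using x m by (force simp: aged_def)
      moreover have "?k \<le> ?m"
        using m missing_subset_useful[OF c, of u v] finite_useful[OF c] by auto
      then have "a ?m \<le> a ?k"
        using x kp in_present[of ?m x u v] m by (auto simp: aged_def)
      then have "r * a ?m \<le> r * a ?k"
        using r by simp
      ultimately show ?thesis by simp
    qed
    then have "(real (card (x u v)) - z u) / r \<le> a ?k"
      using r by (simp add: divide_le_eq mult.commute)
    then show ?thesis using eq by simp
  qed
qed

lemma sum_event:
  fixes f :: "'v::finite event \<Rightarrow> real"
  shows "(\<Sum>e\<in>UNIV. f e) = (\<Sum>u\<in>UNIV. f (Inl u)) + (\<Sum>u\<in>UNIV. \<Sum>v\<in>UNIV. f (Inr (u, v)))"
  by (simp add: sum.Plus sum.cartesian_product o_def flip: UNIV_Plus_UNIV)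

section \<open>The embedded jump chain and its drift\<close>

locale network =
  fixes lam :: "'v::finite \<Rightarrow> real"
  assumes two_nodes: "2 \<le> CARD('v)" and lam_nonneg: "0 \<le> lam u"
begin

definition w :: "'v event \<Rightarrow> real" where
  "w e = rate lam e / total_rate lam"

text \<open>Both the probability that an event belongs to a given link and the mean gap between
  events.\<close>

definition s :: real where
  "s = 1 / total_rate lam"

lemma total_rate_positive: "0 < total_rate lam"
  by (intro total_rate_pos two_nodes lam_nonneg)

lemma s_pos: "0 < s"
  using total_rate_positive by (simp add: s_def)

lemma w_Inl: "w (Inl u) = lam u * s"
  by (simp add: w_def s_def rate_def)

lemma w_Inr: "w (Inr (u, v)) = (if u = v then 0 else s)"
  by (simp add: w_def s_def rate_def)

sublocale event_weights w
proof
  show "0 \<le> w e" for e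
    using total_rate_positive rate_nonneg[of lam e] lam_nonneg by (simp add: w_def)
  show "(\<Sum>e\<in>UNIV. w e) = 1"
    using total_rate_positive by (simp add: w_def total_rate_def flip: sum_divide_distrib)
qed

definition run :: "'v event list \<Rightarrow> 'v state" where
  "run es = fold act es empty_state"

lemma run_simps [simp]: "run [] = empty_state" "run (es @ [e]) = act e (run es)"
  by (simp_all add: run_def)

lemma consistent_reached: "consistent (run es)"
  unfolding run_def by (intro consistent_run two_nodes consistent_empty)

lemma w_le_1: "w e \<le> 1"
  using member_le_sum[of e UNIV w] w_nonneg w_sum by simp

text \<open>Ageing adds \<open>backlog x\<close>; the links remove \<open>s / r\<close> times the
  backlog up to their share of \<open>z\<close>, each \<open>u\<close> occurring in
  \<open>CARD('v)\<close> pairs. For \<open>r < s\<close> the backlog gets a negative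
  coefficient.\<close>

lemma drift_label_sum:
  assumes r: "0 < r" and x: "aged r (x, a, z)"
  shows "(\<Sum>e\<in>UNIV. w e * label_sum (act e x) (age_step e x a))
    \<le> label_sum x a + real CARD('v) - (s / r - 1) * real (backlog x)
      + (s / r) * real CARD('v) * (\<Sum>u\<in>UNIV. z u)"
proof -
  let ?L = "label_sum x a + real (backlog x)"
  let ?c = "\<lambda>e. case e of Inl u \<Rightarrow> w e * real CARD('v)
    | Inr (u, v) \<Rightarrow> (s / r) * z u - (s / r) * real (card (x u v))"
  have c: "consistent x" and z: "0 \<le> z u" for u using x by (simp_all add: aged_def)
  have "w e * label_sum (act e x) (age_step e x a) \<le> w e * ?L + ?c e" for e
  proof (cases e)
    case (Inl u)
    then show ?thesis
      using mult_left_mono[OF label_sum_age_arrive[OF two_nodes c, of u a] w_nonneg[of e]]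
      by (simp add: algebra_simps)
  next
    case (Inr uv)
    obtain u v where uv: "uv = (u, v)" by (cases uv)
    show ?thesis
    proof (cases "u = v")
      \<comment> \<open>Here the weight is 0 and the bound \<open>(s / r) * z u\<close> is
        nonnegative, so the sum may run over all pairs.\<close>
      case True
      then show ?thesis
        using z[of u] s_pos r by (simp add: Inr uv w_Inr consistent_self[OF c])
    next
      case False
      have "w e * label_sum (act e x) (age_step e x a)
          \<le> w e * (?L - (real (card (x u v)) - z u) / r)"
        using mult_left_mono[OF label_sum_age_communicate[OF r x, of u v] w_nonneg[of e]]
        by (simp add: Inr uv)
      then show ?thesis
        using False r by (simp add: Inr uv w_Inr field_simps)
    qed
  qed
  then have "(\<Sum>e\<in>UNIV. w e * label_sum (act e x) (age_step e x a)) \<le> (\<Sum>e\<in>UNIV. w e * ?L + ?c e)"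
    by (intro sum_mono)
  also have "\<dots> = ?L + (\<Sum>e\<in>UNIV. ?c e)"
    by (simp add: sum.distrib w_sum flip: sum_distrib_right)
  also have "(\<Sum>e\<in>UNIV. ?c e) = (\<Sum>u\<in>UNIV. w (Inl u)) * real CARD('v)
      + (s / r) * real CARD('v) * (\<Sum>u\<in>UNIV. z u) - (s / r) * real (backlog x)"
    by (simp add: sum_event backlog_def sum_subtractf sum_distrib_left sum_distrib_right sum_divide_distrib mult_ac)
  also have "(\<Sum>u\<in>UNIV. w (Inl u)) * real CARD('v) \<le> 1 * real CARD('v)"
  proof (rule mult_right_mono)
    have "0 \<le> (\<Sum>u\<in>UNIV. \<Sum>v\<in>UNIV. w (Inr (u, v)))"
      by (intro sum_nonneg w_nonneg)
    then show "(\<Sum>u\<in>UNIV. w (Inl u)) \<le> 1"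
      using w_sum by (simp add: sum_event)
  qed simp
  finally show ?thesis
    by (simp add: algebra_simps)
qed

text \<open>Quadratic drift of a stable queue: truncation at 0 does not raise the square, the mean
  increment before it is at most \<open>- d\<close>, and the squared increment at most 1. The term
  linear in \<open>z u\<close> will absorb the workloads in \<open>drift_label_sum\<close>.\<close>

lemma drift_excess:
  assumes r: "0 \<le> r" "r \<le> 1" and d: "w (Inl u) + d \<le> r" and z: "0 \<le> z u"
  shows "(\<Sum>e\<in>UNIV. w e * (excess_step r e z u)\<^sup>2) \<le> (z u)\<^sup>2 - 2 * d * z u + 1"
proof -
  let ?i = "\<lambda>e. if e = Inl u then 1 else 0 :: real"
  have "w e * (excess_step r e z u)\<^sup>2 \<le> w e * ((z u)\<^sup>2 - 2 * r * z u + 1) + 2 * z u * (w e * ?i e)" for e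
  proof -
    have "(excess_step r e z u)\<^sup>2 \<le> (z u + ?i e - r)\<^sup>2"
      by (auto simp: excess_step_def max_def)
    also have "\<dots> = (z u)\<^sup>2 + 2 * z u * (?i e - r) + (?i e - r)\<^sup>2"
      by (simp add: power2_eq_square algebra_simps)
    also have "(?i e - r)\<^sup>2 \<le> 1"
      using r by (auto simp: abs_square_le_1)
    finally have "(excess_step r e z u)\<^sup>2 \<le> ((z u)\<^sup>2 - 2 * r * z u + 1) + 2 * z u * ?i e"
      by (simp add: algebra_simps)
    from mult_left_mono[OF this w_nonneg[of e]] show ?thesis
      by (simp add: algebra_simps)
  qed
  then have "(\<Sum>e\<in>UNIV. w e * (excess_step r e z u)\<^sup>2)
      \<le> (\<Sum>e\<in>UNIV. w e * ((z u)\<^sup>2 - 2 * r * z u + 1) + 2 * z u * (w e * ?i e))"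
    by (intro sum_mono)
  also have "\<dots> = (\<Sum>e\<in>UNIV. w e) * ((z u)\<^sup>2 - 2 * r * z u + 1) + 2 * z u * (\<Sum>e\<in>UNIV. w e * ?i e)"
    by (simp only: sum.distrib sum_distrib_left sum_distrib_right)
  also have "(\<Sum>e\<in>UNIV. w e * ?i e) = (\<Sum>e\<in>UNIV. if e = Inl u then w e else 0)"
    by (intro sum.cong) auto
  also have "(\<Sum>e\<in>UNIV. w e) * ((z u)\<^sup>2 - 2 * r * z u + 1) + 2 * z u * \<dots>
      = ((z u)\<^sup>2 - 2 * r * z u + 1) + 2 * z u * w (Inl u)"
    by (simp add: w_sum)
  also have "\<dots> \<le> (z u)\<^sup>2 - 2 * d * z u + 1"
    using mult_left_mono[OF d, of "2 * z u"] z by (simp add: algebra_simps)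
  finally show ?thesis .
qed

lemma mean_backlog_bounded:
  assumes "\<And>u. lam u < 1"
  shows "\<exists>C>0. \<forall>T. (\<Sum>n<T. mean w n (\<lambda>es. real (backlog (run es)))) \<le> C * real T"
proof -
  let ?N = "real CARD('v)"
  \<comment> \<open>\<open>r\<close> is the midpoint between the largest arrival probability
    \<open>p\<close> and the link probability \<open>s\<close>, and \<open>d\<close> is its distance
    from both.\<close>
  define p where "p = Max (range (\<lambda>u. w (Inl u)))"
  define r where "r = (p + s) / 2"
  define d where "d = (s - p) / 2"
  \<comment> \<open>Chosen so that \<open>K * (2 * d)\<close> equals \<open>(s / r) * ?N\<close>:
    the terms linear in the workloads then cancel.\<close>
  define K where "K = (s / r) * ?N / (2 * d)"
  have wp: "w (Inl u) \<le> p" for u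
    unfolding p_def by (intro Max_ge) auto
  have "p \<in> range (\<lambda>u. w (Inl u))"
    unfolding p_def by (intro Max_in) auto
  then have p: "0 \<le> p" "p < s"
    using lam_nonneg assms s_pos by (auto simp: w_Inl less_imp_le)
  obtain u v :: 'v where "u \<noteq> v"
    using two_nodes by (metis (full_types) UNIV_I card_2_iff' ex_card)
  then have s1: "s \<le> 1"
    using w_le_1[of "Inr (u, v)"] by (simp add: w_Inr)
  have r: "0 < r" "r \<le> 1" "r < s" and d: "0 < d" "w (Inl u) + d \<le> r" for u
    using p s1 wp[of u] by (auto simp: r_def d_def field_simps)
  have K: "0 \<le> K" using s_pos r d by (simp add: K_def)
  \<comment> \<open>Ages and workloads are recomputed from the history, which makes the Lyapunov
    function a function of event lists with initial value 0.\<close>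
  let ?st = "\<lambda>es. fold (step r) es (empty_state :: 'v state, \<lambda>_. 0, \<lambda>_. 0 :: real)"
  define L where "L = (\<lambda>(x, a, z). label_sum (x :: 'v state) a + K * (\<Sum>u\<in>(UNIV :: 'v set). (z u)\<^sup>2))"
  have aged: "aged r (?st es)" for es
  proof (induction es rule: rev_induct)
    case Nil
    then show ?case
      by (simp add: aged_def consistent_empty) (simp add: present_def empty_state_def)
  next
    case (snoc e es)
    then show ?case
      using aged_step[OF two_nodes, of r _ _ _ e] r by (cases "?st es") auto
  qed
  have fst: "fst (?st es) = run es" for es
    by (induction es rule: rev_induct) (auto simp: step_def split: prod.split)
  have drift: "(\<Sum>e\<in>UNIV. w e * L (?st (es @ [e])))
      \<le> L (?st es) + (?N + K * ?N) - (s / r - 1) * real (backlog (run es))" for es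
  proof -
    obtain x a z where st: "?st es = (x, a, z)" by (cases "?st es")
    have x: "x = run es" using fst[of es] st by simp
    have ag: "aged r (x, a, z)" using aged[of es] st by simp
    have "(\<Sum>e\<in>UNIV. w e * L (?st (es @ [e])))
        = (\<Sum>e\<in>UNIV. w e * label_sum (act e x) (age_step e x a))
          + K * (\<Sum>u\<in>UNIV. \<Sum>e\<in>UNIV. w e * (excess_step r e z u)\<^sup>2)"
      by (subst sum.swap)
        (simp add: st L_def step_def distrib_left sum.distrib sum_distrib_left mult.left_commute)
    also have "\<dots> \<le> (label_sum x a + ?N - (s / r - 1) * real (backlog x)
          + (s / r) * ?N * (\<Sum>u\<in>UNIV. z u))
          + K * (\<Sum>u\<in>UNIV. (z u)\<^sup>2 - 2 * d * z u + 1)"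
      using ag r d K
      by (intro add_mono drift_label_sum mult_left_mono sum_mono drift_excess) (auto simp: aged_def)
    also have "K * (\<Sum>u\<in>UNIV. (z u)\<^sup>2 - 2 * d * z u + 1)
        = K * (\<Sum>u\<in>UNIV. (z u)\<^sup>2) - K * (2 * d) * (\<Sum>u\<in>UNIV. z u) + K * ?N"
    proof -
      have "(\<Sum>u\<in>UNIV. (z u)\<^sup>2 - 2 * d * z u + 1) = (\<Sum>u\<in>UNIV. (z u)\<^sup>2) - 2 * d * (\<Sum>u\<in>UNIV. z u) + ?N"
        by (simp add: sum.distrib sum_subtractf flip: sum_distrib_left)
      then show ?thesis by (simp only: right_diff_distrib distrib_left mult.assoc)
    qed
    also have "K * (2 * d) = (s / r) * ?N"
      using d by (simp add: K_def)
    finally show ?thesis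
      by (simp add: x st L_def algebra_simps)
  qed
  have "0 \<le> L (?st es)" for es
    using aged[of es] K label_sum_age_nonneg
    by (cases "?st es") (auto simp: L_def intro!: add_nonneg_nonneg mult_nonneg_nonneg sum_nonneg)
  from sum_mean_drift[OF drift this]
  have *: "(s / r - 1) * (\<Sum>n<T. mean w n (\<lambda>es. real (backlog (run es)))) \<le> (?N + K * ?N) * real T" for T
    by (simp add: L_def label_sum_def empty_state_def)
  have pos: "0 < s / r - 1" using r by simp
  have "(\<Sum>n<T. mean w n (\<lambda>es. real (backlog (run es)))) \<le> (?N + K * ?N) / (s / r - 1) * real T" for T
    using *[of T] pos by (simp add: pos_le_divide_eq mult.commute)
  moreover have "0 < (?N + K * ?N) / (s / r - 1)"
    using pos K two_nodes by (intro divide_pos_pos add_pos_nonneg) auto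
  ultimately show ?thesis by blast
qed

section \<open>Recurrence of the jump chain\<close>

text \<open>Tail of the return time of the jump chain. An event that leaves \<open>x\<close>
  unchanged counts as a return here, unlike in \<open>away\<close> below.\<close>

definition avoid :: "'v state \<Rightarrow> nat \<Rightarrow> real" where
  "avoid x m = mean w m (\<lambda>fs. of_bool (\<forall>j\<in>{1..m}. fold act (take j fs) x \<noteq> x))"

definition visit :: "'v state \<Rightarrow> nat \<Rightarrow> real" where
  "visit x k = mean w k (\<lambda>es. of_bool (run es = x))"

lemma avoid_nonneg: "0 \<le> avoid x m"
  unfolding avoid_def by (rule mean_nonneg) simp

lemma visit_nonneg: "0 \<le> visit x k"
  unfolding visit_def by (rule mean_nonneg) simp

text \<open>After a visit at time \<open>k\<close> the chain starts afresh, so each summand is the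
  probability that the last visit up to time \<open>n\<close> happens at \<open>k\<close>; these
  events are disjoint.\<close>

lemma last_visit: "(\<Sum>k\<le>n. visit x k * avoid x (n - k)) \<le> 1"
proof -
  define P where "P k es \<longleftrightarrow> run (take k es) = x \<and> (\<forall>j\<in>{k<..n}. run (take j es) \<noteq> x)" for k es
  have eq: "visit x k * avoid x (n - k) = mean w n (\<lambda>es. of_bool (P k es))" if "k \<le> n" for k
  proof -
    have "P k (es @ fs) \<longleftrightarrow> run es = x \<and> (\<forall>j\<in>{1..n-k}. fold act (take j fs) x \<noteq> x)"
      if len: "length es = k" for es fs
    proof -
      have "(\<forall>j\<in>{k<..n}. run (take j (es @ fs)) \<noteq> x) \<longleftrightarrow> (\<forall>j\<in>{1..n-k}. run (es @ take j fs) \<noteq> x)"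
      proof (intro iffI ballI)
        fix j assume "\<forall>j\<in>{k<..n}. run (take j (es @ fs)) \<noteq> x" "j \<in> {1..n-k}"
        then have "run (take (k + j) (es @ fs)) \<noteq> x" by auto
        then show "run (es @ take j fs) \<noteq> x" by (simp add: len)
      next
        fix j assume "\<forall>j\<in>{1..n-k}. run (es @ take j fs) \<noteq> x" and j: "j \<in> {k<..n}"
        moreover have "j - k \<in> {1..n-k}" using j by auto
        ultimately have "run (es @ take (j - k) fs) \<noteq> x" by blast
        then show "run (take j (es @ fs)) \<noteq> x" using j len by simp
      qed
      then show ?thesis by (auto simp: P_def len run_def)
    qed
    then have "mean w (n - k) (\<lambda>fs. of_bool (P k (es @ fs))) = of_bool (run es = x) * avoid x (n - k)"
      if "length es = k" for es
      using that by (simp add: avoid_def of_bool_conj flip: mean_cmult)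
    then have "mean w (k + (n - k)) (\<lambda>es. of_bool (P k es)) = mean w k (\<lambda>es. of_bool (run es = x) * avoid x (n - k))"
      unfolding mean_append by (intro mean_cong)
    then show ?thesis
      using that by (simp add: visit_def mean_cmult_right)
  qed
  have le1: "(\<Sum>k\<le>n. of_bool (P k es) :: real) \<le> 1" for es
  proof -
    have "card {k \<in> {..n}. P k es} \<le> Suc 0"
    proof (subst card_le_Suc0_iff_eq)
      show "\<forall>i\<in>{k \<in> {..n}. P k es}. \<forall>j\<in>{k \<in> {..n}. P k es}. i = j"
        by (intro ballI, rule linorder_cases) (auto simp: P_def)
    qed auto
    then show ?thesis by (simp add: Int_def)
  qed
  have "(\<Sum>k\<le>n. visit x k * avoid x (n - k)) = mean w n (\<lambda>es. \<Sum>k\<le>n. of_bool (P k es))"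
    unfolding mean_sum by (intro sum.cong) (simp_all add: eq)
  also have "\<dots> \<le> mean w n (\<lambda>es. 1)"
    by (intro mean_mono le1)
  finally show ?thesis by (simp add: mean_const)
qed

text \<open>The rectangle \<open>k < T\<close>, \<open>j \<le> T\<close> lies in the triangle
  \<open>k + j < 2 * T\<close>, where \<open>last_visit\<close> applies to each diagonal. Visits at
  a positive frequency thus force the tails of the return time to have bounded sums.\<close>

lemma visits_times_avoid: "(\<Sum>k<T. visit x k) * (\<Sum>j\<le>T. avoid x j) \<le> 2 * real T"
proof -
  have "(\<Sum>k<T. visit x k) * (\<Sum>j\<le>T. avoid x j)
      = (\<Sum>(k, j)\<in>{..<T} \<times> {..T}. visit x k * avoid x j)"
    by (simp add: sum_product sum.cartesian_product)
  also have "\<dots> \<le> (\<Sum>(k, j)\<in>{(k, j). k + j < 2 * T}. visit x k * avoid x j)"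
  proof (rule sum_mono2)
    have "{(k, j). k + j < 2 * T} \<subseteq> {..2*T} \<times> {..2*T}" by auto
    then show "finite {(k, j). k + j < 2 * T}"
      by (rule finite_subset) simp
  qed (auto simp: visit_nonneg avoid_nonneg)
  also have "\<dots> = (\<Sum>n<2 * T. \<Sum>k\<le>n. visit x k * avoid x (n - k))"
    by (rule sum.triangle_reindex)
  also have "\<dots> \<le> (\<Sum>n<2 * T. 1)"
    by (intro sum_mono last_visit)
  finally show ?thesis by simp
qed

lemma reachable_path:
  "x \<in> reachable lam \<Longrightarrow> \<exists>es. run es = x \<and> 0 < prod_list (map w es)"
proof (induction rule: reachable.induct)
  case empty
  then show ?case by (intro exI[of _ "[]"]) simp
next
  case (step x e)
  then obtain es where "run es = x" "0 < prod_list (map w es)" by blast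
  moreover have "0 < w e" using step total_rate_positive by (simp add: w_def)
  ultimately show ?case by (intro exI[of _ "es @ [e]"]) simp
qed

text \<open>From a backlog of at most \<open>M\<close>, some \<open>M\<close> communications, of
  probability \<open>s ^ M\<close>, empty the network, and a fixed path then leads to
  \<open>x\<close>. Neither constant nor delay depends on \<open>n\<close>.\<close>

lemma visit_ge_backlog:
  assumes "x \<in> reachable lam"
  shows "\<exists>c>0. \<exists>K. \<forall>n. c * mean w n (\<lambda>es. of_bool (backlog (run es) \<le> M)) \<le> visit x (n + K)"
proof -
  obtain gs where gs: "run gs = x" "0 < prod_list (map w gs)"
    using reachable_path[OF assms] by blast
  let ?K = "M + length gs"
  let ?c = "s ^ M * prod_list (map w gs)"
  have "?c * of_bool (backlog (run es) \<le> M) \<le> mean w ?K (\<lambda>fs. of_bool (run (es @ fs) = x))" for es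
  proof (cases "backlog (run es) \<le> M")
    case True
    obtain fs where fs: "length fs = M" "\<forall>e\<in>set fs. \<exists>u v. e = Inr (u, v) \<and> u \<noteq> v"
        "fold act fs (run es) = empty_state"
      using drain[OF two_nodes consistent_reached True] by blast
    have "map w fs = map (\<lambda>_. s) fs"
      using fs(2) by (auto simp: w_Inr)
    then have "prod_list (map w fs) = s ^ M"
      using fs(1) by (simp add: map_replicate_const)
    moreover have "run (es @ fs @ gs) = x"
      using fs(3) gs(1) by (simp add: run_def)
    ultimately show ?thesis
      using mean_ge_path[of "\<lambda>fs. of_bool (run (es @ fs) = x)" "fs @ gs"] True fs(1) by simp
  qed (simp add: mean_nonneg)
  then have "mean w n (\<lambda>es. ?c * of_bool (backlog (run es) \<le> M))
      \<le> mean w n (\<lambda>es. mean w ?K (\<lambda>fs. of_bool (run (es @ fs) = x)))" for n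
    by (intro mean_mono)
  then have "?c * mean w n (\<lambda>es. of_bool (backlog (run es) \<le> M)) \<le> visit x (n + ?K)" for n
    by (simp only: visit_def mean_append[of w n ?K] mean_cmult)
  moreover have "0 < ?c" using gs s_pos by simp
  ultimately show ?thesis by blast
qed

lemma sum_avoid_bounded:
  assumes "\<And>u. lam u < 1" and x: "x \<in> reachable lam"
  shows "\<exists>B. \<forall>T. (\<Sum>j<T. avoid x j) \<le> B"
proof -
  obtain C where C: "0 < C" "\<And>T. (\<Sum>n<T. mean w n (\<lambda>es. real (backlog (run es)))) \<le> C * real T"
    using mean_backlog_bounded[OF assms(1)] by blast
  \<comment> \<open>By Markov's inequality, with this \<open>M\<close> the backlog is at most
    \<open>M\<close> during at least half of the time on average.\<close>
  define M where "M = nat \<lceil>2 * C\<rceil>"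
  have M: "0 < real M" "2 * C \<le> real M"
    using C(1) by (auto simp: M_def)
  obtain c K where c: "0 < c"
    and K: "\<And>n. c * mean w n (\<lambda>es. of_bool (backlog (run es) \<le> M)) \<le> visit x (n + K)"
    using visit_ge_backlog[OF x, of M] by blast
  have half: "real T / 2 \<le> (\<Sum>n<T. mean w n (\<lambda>es. of_bool (backlog (run es) \<le> M)))" for T
  proof -
    have "1 - (1 / real M) * mean w n (\<lambda>es. real (backlog (run es)))
        \<le> mean w n (\<lambda>es. of_bool (backlog (run es) \<le> M))" for n
    proof -
      have "1 - (1 / real M) * real (backlog (run es)) \<le> of_bool (backlog (run es) \<le> M)" for es
        using M(1) by (auto simp: field_simps)
      then have "mean w n (\<lambda>es. 1 - (1 / real M) * real (backlog (run es)))
          \<le> mean w n (\<lambda>es. of_bool (backlog (run es) \<le> M))"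
        by (intro mean_mono)
      then show ?thesis by (simp only: mean_diff mean_cmult mean_const)
    qed
    then have "(\<Sum>n<T. 1 - (1 / real M) * mean w n (\<lambda>es. real (backlog (run es))))
        \<le> (\<Sum>n<T. mean w n (\<lambda>es. of_bool (backlog (run es) \<le> M)))"
      by (intro sum_mono)
    moreover have "(1 / real M) * (\<Sum>n<T. mean w n (\<lambda>es. real (backlog (run es)))) \<le> real T / 2"
    proof -
      have "(1 / real M) * (\<Sum>n<T. mean w n (\<lambda>es. real (backlog (run es)))) \<le> (1 / real M) * (C * real T)"
        using C(2) by (intro mult_left_mono) auto
      also have "\<dots> = C / real M * real T" by simp
      also have "C / real M \<le> 1 / 2" using M by (simp add: field_simps)
      finally show ?thesis by (simp add: mult_right_mono)
    qed
    ultimately show ?thesis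
      by (simp add: sum_subtractf sum_distrib_left)
  qed
  have visits: "c * real T / 2 \<le> (\<Sum>k<T + K. visit x k)" for T
  proof -
    have "c * real T / 2 \<le> c * (\<Sum>n<T. mean w n (\<lambda>es. of_bool (backlog (run es) \<le> M)))"
      using half[of T] c by simp
    also have "\<dots> \<le> (\<Sum>n<T. visit x (n + K))"
      unfolding sum_distrib_left by (intro sum_mono K)
    also have "\<dots> = (\<Sum>k\<in>(\<lambda>n. n + K) ` {..<T}. visit x k)"
      by (subst sum.reindex) (auto simp: inj_on_def)
    also have "\<dots> \<le> (\<Sum>k<T + K. visit x k)"
      by (intro sum_mono2) (auto simp: visit_nonneg)
    finally show ?thesis .
  qed
  have "(\<Sum>j<T. avoid x j) \<le> 8 / c" for T
  proof -
    \<comment> \<open>Since \<open>R > K\<close>, the bound \<open>2 * (R + K)\<close> is at most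
      \<open>4 * R\<close>; cancelling \<open>R\<close> leaves \<open>8 / c\<close>, independent of
      \<open>T\<close>.\<close>
    define R where "R = T + K + 1"
    have "c * real R / 2 * (\<Sum>j\<le>R + K. avoid x j) \<le> (\<Sum>k<R + K. visit x k) * (\<Sum>j\<le>R + K. avoid x j)"
      by (intro mult_right_mono visits sum_nonneg avoid_nonneg)
    also have "\<dots> \<le> 2 * real (R + K)"
      by (rule visits_times_avoid)
    also have "\<dots> \<le> 4 * real R"
      by (simp add: R_def)
    finally have "c * real R / 2 * (\<Sum>j\<le>R + K. avoid x j) \<le> 4 * real R" .
    moreover have "real R * (c * (\<Sum>j\<le>R + K. avoid x j)) = 2 * (c * real R / 2 * (\<Sum>j\<le>R + K. avoid x j))"
      by (simp only: times_divide_eq_left nonzero_mult_div_cancel_left mult.assoc mult.left_commute)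
    ultimately have "real R * (c * (\<Sum>j\<le>R + K. avoid x j)) \<le> real R * 8"
      by linarith
    then have "c * (\<Sum>j\<le>R + K. avoid x j) \<le> 8"
      by (rule mult_left_le_imp_le) (simp add: R_def)
    then have "(\<Sum>j\<le>R + K. avoid x j) \<le> 8 / c"
      using c by (simp only: pos_le_divide_eq mult.commute)
    moreover have "(\<Sum>j<T. avoid x j) \<le> (\<Sum>j\<le>R + K. avoid x j)"
      by (intro sum_mono2) (auto simp: R_def avoid_nonneg)
    ultimately show ?thesis
      by linarith
  qed
  then show ?thesis by blast
qed

section \<open>Returns after the state has been left, the discrete form of
  \<open>return_time\<close>\<close>

definition returned :: "'v state \<Rightarrow> 'v event list \<Rightarrow> bool" where
  "returned x fs \<longleftrightarrow> (\<exists>j\<le>length fs. \<exists>i<j. fold act (take j fs) x = x \<and> fold act (take i fs) x \<noteq> x)"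

definition away :: "'v state \<Rightarrow> nat \<Rightarrow> real" where
  "away x m = mean w m (\<lambda>fs. of_bool (\<not> returned x fs))"

lemma away_nonneg: "0 \<le> away x m"
  unfolding away_def by (rule mean_nonneg) simp

text \<open>Transfers the lower bound on \<open>avoid\<close> to \<open>away\<close> in the
  overloaded network.\<close>

lemma avoid_le_away: "avoid x m \<le> away x m"
  unfolding avoid_def away_def
proof (rule mean_mono)
  fix fs :: "'v event list" assume len: "length fs = m"
  have "\<not> returned x fs" if "\<forall>j\<in>{1..m}. fold act (take j fs) x \<noteq> x"
    using that len by (fastforce simp: returned_def)
  then show "of_bool (\<forall>j\<in>{1..m}. fold act (take j fs) x \<noteq> x) \<le> (of_bool (\<not> returned x fs) :: real)"
    by simp
qed

lemma returned_Cons_stay: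
  assumes "act e x = x"
  shows "returned x (e # fs) \<longleftrightarrow> returned x fs"
proof
  assume "returned x (e # fs)"
  then obtain i j where ij: "j \<le> Suc (length fs)" "i < j" "fold act (take j (e # fs)) x = x"
      "fold act (take i (e # fs)) x \<noteq> x"
    by (auto simp: returned_def)
  then obtain i' where "i = Suc i'" by (cases i) auto
  moreover obtain j' where "j = Suc j'" using ij by (cases j) auto
  ultimately have "j' \<le> length fs" "i' < j'" "fold act (take j' fs) x = x" "fold act (take i' fs) x \<noteq> x"
    using ij assms by auto
  then show "returned x fs"
    unfolding returned_def by blast
next
  assume "returned x fs"
  then obtain i j where "j \<le> length fs" "i < j" "fold act (take j fs) x = x" "fold act (take i fs) x \<noteq> x"
    by (auto simp: returned_def)
  then have "Suc j \<le> length (e # fs)" "Suc i < Suc j"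
      "fold act (take (Suc j) (e # fs)) x = x" "fold act (take (Suc i) (e # fs)) x \<noteq> x"
    using assms by auto
  then show "returned x (e # fs)"
    unfolding returned_def by blast
qed

lemma returned_Cons_leave:
  assumes "act e x \<noteq> x"
  shows "returned x (e # fs) \<longleftrightarrow> (\<exists>j\<in>{1..Suc (length fs)}. fold act (take j (e # fs)) x = x)"
proof
  assume "\<exists>j\<in>{1..Suc (length fs)}. fold act (take j (e # fs)) x = x"
  then obtain j where j: "1 \<le> j" "j \<le> Suc (length fs)" "fold act (take j (e # fs)) x = x" by auto
  then have "j \<noteq> 1" using assms by auto
  then have "1 < j" "fold act (take 1 (e # fs)) x \<noteq> x" using j assms by auto
  then show "returned x (e # fs)"
    using j unfolding returned_def by (metis length_Cons)
qed (auto simp: returned_def intro!: bexI)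

text \<open>Staying put costs a geometric number of events, so only the excursions matter.\<close>

lemma away_Suc: "away x (Suc m) = (\<Sum>e | act e x = x. w e) * away x m + avoid x (Suc m)"
proof -
  let ?A = "\<lambda>e fs. of_bool (\<forall>j\<in>{1..Suc m}. fold act (take j (e # fs)) x \<noteq> x) :: real"
  have "mean w m (\<lambda>fs. of_bool (\<not> returned x (e # fs)))
      = of_bool (act e x = x) * away x m + mean w m (?A e)" for e
  proof (cases "act e x = x")
    case True
    \<comment> \<open>Staying in \<open>x\<close> is a visit at time 1, so \<open>avoid\<close>
      contributes nothing.\<close>
    then have "?A e fs = 0" for fs
      by (auto intro!: bexI[of _ 1])
    then have "mean w m (?A e) = 0"
      by (simp only: mean_const)
    then show ?thesis
      using True by (simp add: away_def returned_Cons_stay del: take_Suc_Cons)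
  next
    case False
    then show ?thesis
      by (auto simp: returned_Cons_leave simp del: take_Suc_Cons intro!: mean_cong)
  qed
  then have "away x (Suc m) = (\<Sum>e\<in>UNIV. w e * of_bool (act e x = x)) * away x m + avoid x (Suc m)"
    by (simp only: away_def avoid_def mean.simps distrib_left sum.distrib sum_distrib_right mult.assoc)
  also have "(\<Sum>e\<in>UNIV. w e * of_bool (act e x = x)) = (\<Sum>e | act e x = x. w e)"
    by simp
  finally show ?thesis .
qed

text \<open>Summing \<open>away_Suc\<close> gives \<open>A \<le> 1 + q * A + B\<close> for the
  partial sums \<open>A\<close>, where \<open>q\<close> is the probability of an event that fixes
  \<open>x\<close>; it is below 1 as \<open>x\<close> is not absorbing.\<close>

lemma sum_away_bounded:
  assumes lam: "\<And>u. lam u < 1" and x: "x \<in> reachable lam" and na: "\<not> absorbing lam x"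
  shows "\<exists>B. \<forall>T. (\<Sum>j<T. away x j) \<le> B"
proof -
  obtain B where B: "\<And>T. (\<Sum>j<T. avoid x j) \<le> B"
    using sum_avoid_bounded[OF lam x] by blast
  let ?q = "\<Sum>e | act e x = x. w e"
  obtain e where e: "0 < rate lam e" "act e x \<noteq> x"
    using na by (auto simp: absorbing_def)
  have "?q \<le> (\<Sum>e\<in>UNIV - {e}. w e)"
    using e by (intro sum_mono2) (auto simp: w_nonneg)
  also have "\<dots> = 1 - w e"
    by (simp add: sum_diff1 w_sum)
  also have "\<dots> < 1"
    using e total_rate_positive by (simp add: w_def)
  finally have q: "?q < 1" .
  have q0: "0 \<le> ?q" by (intro sum_nonneg w_nonneg)
  have "(\<Sum>j<T. away x j) \<le> (1 + B) / (1 - ?q)" for T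
  proof -
    have "(\<Sum>j<Suc T. away x j) = away x 0 + ?q * (\<Sum>j<T. away x j) + (\<Sum>j<T. avoid x (Suc j))"
      by (simp only: sum.lessThan_Suc_shift away_Suc sum.distrib sum_distrib_left add.assoc)
    moreover have "(\<Sum>j<T. avoid x (Suc j)) \<le> B"
      using B[of "Suc T"] avoid_nonneg[of x 0] unfolding sum.lessThan_Suc_shift by linarith
    moreover have "away x 0 \<le> 1"
      by (simp add: away_def)
    moreover have "(\<Sum>j<T. away x j) \<le> (\<Sum>j<Suc T. away x j)"
      by (simp add: away_nonneg)
    ultimately have "(1 - ?q) * (\<Sum>j<T. away x j) \<le> 1 + B"
      by (simp add: algebra_simps)
    then show ?thesis
      using q by (simp add: pos_le_divide_eq mult.commute)
  qed
  then show ?thesis by blast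
qed

text \<open>At load at least one the backlog is a submartingale, whereas it vanishes at a return to the
  empty state: its mean is carried by the event that no return occurred.\<close>

lemma drift_backlog:
  assumes l: "\<And>u. lam u = l" "1 \<le> l" and x: "consistent x"
  shows "real (backlog x) \<le> (\<Sum>e\<in>UNIV. w e * real (backlog (act e x)))"
proof -
  let ?N = "real CARD('v)"
  have "(\<Sum>u\<in>UNIV. w (Inl u) * real (backlog (act (Inl u) x)))
      = (\<Sum>u\<in>(UNIV :: 'v set). w (Inl u)) * real (backlog x) + ?N * (l * s * (?N - 1))"
    by (simp add: backlog_arrive[OF two_nodes x] w_Inl l distrib_left sum.distrib sum_distrib_right)
  moreover have "(\<Sum>u\<in>UNIV. \<Sum>v\<in>UNIV. w (Inr (u, v)) * real (backlog x)) - s * (?N * (?N - 1))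
      \<le> (\<Sum>u\<in>UNIV. \<Sum>v\<in>UNIV. w (Inr (u, v)) * real (backlog (act (Inr (u, v)) x)))"
  proof -
    have "(\<Sum>v\<in>UNIV. w (Inr (u, v)) * real (backlog x)) - s * (?N - 1)
        \<le> (\<Sum>v\<in>UNIV. w (Inr (u, v)) * real (backlog (act (Inr (u, v)) x)))" for u
    proof -
      have "(\<Sum>v\<in>UNIV. w (Inr (u, v))) = (\<Sum>v\<in>UNIV - {u}. s)"
        by (intro sum.mono_neutral_cong_right) (auto simp: w_Inr)
      also have "\<dots> = s * (?N - 1)"
        using two_nodes by (simp add: card_Diff_singleton of_nat_diff)
      finally have "(\<Sum>v\<in>UNIV. w (Inr (u, v)) * real (backlog x)) - s * (?N - 1)
          = (\<Sum>v\<in>UNIV. w (Inr (u, v)) * (real (backlog x) - 1))"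
        by (simp add: right_diff_distrib sum_subtractf)
      also have "\<dots> \<le> (\<Sum>v\<in>UNIV. w (Inr (u, v)) * real (backlog (act (Inr (u, v)) x)))"
        by (intro sum_mono mult_left_mono w_nonneg) (simp add: backlog_communicate[OF x])
      finally show ?thesis .
    qed
    from sum_mono[OF this, where K = UNIV] show ?thesis
      by (simp add: sum_subtractf mult_ac)
  qed
  moreover have "(\<Sum>u\<in>(UNIV :: 'v set). w (Inl u)) * real (backlog x)
      + (\<Sum>u\<in>UNIV. \<Sum>v\<in>UNIV. w (Inr (u, v)) * real (backlog x)) = real (backlog x)"
    using w_sum by (simp add: sum_event flip: sum_distrib_right distrib_right)
  \<comment> \<open>Here the load enters: \<open>?N\<close> sources create \<open>?N - 1\<close>
    copies per packet at rate \<open>l\<close>, while each of the \<open>?N * (?N - 1)\<close> links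
    removes at most one copy per epoch.\<close>
  moreover have "s * (?N * (?N - 1)) \<le> ?N * (l * s * (?N - 1))"
    using mult_right_mono[OF l(2), of "s * (?N * (?N - 1))"] s_pos two_nodes by (simp add: mult_ac)
  ultimately show ?thesis
    unfolding sum_event by linarith
qed

lemma backlog_run_le: "real (backlog (run es)) \<le> real CARD('v) * real (length es)"
proof (induction es rule: rev_induct)
  case Nil
  then show ?case by (simp add: backlog_empty)
next
  case (snoc e es)
  have "real (backlog (act e (run es))) \<le> real (backlog (run es)) + real CARD('v)"
    using backlog_arrive[OF two_nodes consistent_reached] backlog_communicate[OF consistent_reached]
    by (cases e) auto
  then show ?case
    using snoc by (simp add: algebra_simps)
qed

text \<open>The mean backlog on the event of no return never falls below its value \<open>d\<close>
  after one event, yet it is at most \<open>?N * m\<close> times the probability of that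
  event.\<close>

lemma avoid_empty_ge:
  assumes l: "\<And>u. lam u = l" "1 \<le> l"
  shows "\<exists>d>0. \<forall>m. d / real (Suc m) \<le> avoid empty_state (Suc m)"
proof -
  let ?N = "real CARD('v)"
  define G where "G m fs \<longleftrightarrow> (\<forall>j\<in>{1..m}. run (take j fs) \<noteq> empty_state)" for m fs
  define F where "F m fs = of_bool (G m fs) * real (backlog (run fs))" for m fs
  define d where "d = (\<Sum>e\<in>UNIV. w e * real (backlog (act e (empty_state :: 'v state))))"
  \<comment> \<open>A return at the last event makes the backlog 0, so the indicator only has to
    cover the earlier events, and the submartingale bound applies.\<close>
  have F_Suc: "F (Suc m) (fs @ [e]) = of_bool (G m fs) * real (backlog (act e (run fs)))"
    if "length fs = m" for m fs e
  proof -
    have "G (Suc m) (fs @ [e]) \<longleftrightarrow> G m fs \<and> act e (run fs) \<noteq> empty_state"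
      using that by (auto simp: G_def atLeastAtMostSuc_conv)
    then show ?thesis
      by (auto simp: F_def backlog_empty)
  qed
  have step: "mean w (Suc m) (F (Suc m))
      = mean w m (\<lambda>fs. of_bool (G m fs) * (\<Sum>e\<in>UNIV. w e * real (backlog (act e (run fs)))))" for m
    unfolding mean_snoc
    by (intro mean_cong) (simp add: F_Suc sum_distrib_left mult.left_commute)
  have d_le: "d \<le> mean w (Suc m) (F (Suc m))" for m
  proof (induction m)
    case 0
    show ?case unfolding step by (simp add: G_def d_def)
  next
    case (Suc m)
    have "mean w (Suc m) (F (Suc m)) \<le> mean w (Suc (Suc m)) (F (Suc (Suc m)))"
      unfolding step[of "Suc m"] unfolding F_def
      by (intro mean_mono mult_left_mono drift_backlog[OF l] consistent_reached) simp
    then show ?case using Suc by linarith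
  qed
  have "mean w m (F m) \<le> ?N * real m * avoid empty_state m" for m
    unfolding avoid_def mean_cmult[symmetric]
    by (intro mean_mono) (auto simp: F_def G_def run_def backlog_run_le[unfolded run_def])
  with d_le have "d \<le> ?N * real (Suc m) * avoid empty_state (Suc m)" for m
    by (meson order_trans)
  then have "d / ?N / real (Suc m) \<le> avoid empty_state (Suc m)" for m
    using two_nodes by (simp add: divide_le_eq mult_ac del: of_nat_Suc)
  moreover have "0 < d"
  proof -
    have "0 < real (backlog (act (Inl undefined) (empty_state :: 'v state)))"
      using backlog_arrive[OF two_nodes consistent_empty, of undefined] two_nodes
      by (simp add: backlog_empty)
    then have "0 < w (Inl undefined) * real (backlog (act (Inl undefined) (empty_state :: 'v state)))"
      using l s_pos by (intro mult_pos_pos) (simp_all add: w_Inl)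
    then show ?thesis
      unfolding d_def by (intro sum_pos2[where i = "Inl undefined"]) (auto simp: w_nonneg)
  qed
  ultimately show ?thesis
    using two_nodes by (intro exI[of _ "d / ?N"]) auto
qed

lemma not_summable_away:
  assumes l: "\<And>u. lam u = l" "1 \<le> l"
  shows "\<not> summable (away empty_state)"
proof
  obtain d where d: "0 < d" "\<And>m. d / real (Suc m) \<le> avoid empty_state (Suc m)"
    using avoid_empty_ge[OF l] by blast
  assume "summable (away empty_state)"
  then have "summable (\<lambda>m. away empty_state (Suc m))"
    by (simp add: summable_Suc_iff)
  then have "summable (\<lambda>m. d / real (Suc m))"
    using d by (rule_tac summable_comparison_test') (auto intro: order_trans[OF _ avoid_le_away])
  then have "summable (\<lambda>m. 1 / d * (d / real (Suc m)))"
    by (rule summable_mult)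
  then show False
    using d(1) not_summable_harmonic[where 'a = real] summable_Suc_iff[of "\<lambda>n. inverse (real n)"]
    by (simp add: field_simps)
qed

end

section \<open>Return times in continuous time\<close>

lemma finite_downset_eq_lessThan:
  fixes A :: "nat set"
  assumes "finite A" and "\<And>m n. n \<in> A \<Longrightarrow> m \<le> n \<Longrightarrow> m \<in> A"
  shows "A = {..<card A}"
proof -
  have "\<exists>k. A = {..<k}"
  proof (cases "A = {}")
    case False
    then have "A = {..<Suc (Max A)}"
      using assms(2)[OF Max_in[OF assms(1) False]] Max_ge[OF assms(1)]
      unfolding lessThan_Suc_atMost atMost_def by blast
    then show ?thesis by blast
  qed auto
  then show ?thesis by (metis card_lessThan)
qed

context
  fixes g :: "real stream"
  assumes pos: "\<And>n. 0 < g !! n"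
begin

lemma epoch_Suc: "epoch g (Suc n) = epoch g n + g !! Suc n"
  by (simp add: epoch_def)

lemma strict_mono_epoch: "strict_mono (epoch g)"
proof (rule strict_monoI_Suc)
  show "epoch g n < epoch g (Suc n)" for n
    using pos[of "Suc n"] by (simp add: epoch_Suc)
qed

lemma epoch_pos: "0 < epoch g n"
  unfolding epoch_def by (intro sum_pos) (auto simp: pos)

lemma epochs_until_epoch: "epochs_until g (epoch g n) = Suc n"
proof -
  have "{m. epoch g m \<le> epoch g n} = {..n}"
    using strict_mono_less_eq[OF strict_mono_epoch] by auto
  then show ?thesis by (simp add: epochs_until_def)
qed

lemma epochs_until_finite:
  assumes "finite {n. epoch g n \<le> t}"
  shows "{n. epoch g n \<le> t} = {..<epochs_until g t}"
  unfolding epochs_until_def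
proof (rule finite_downset_eq_lessThan[OF assms])
  fix m n assume n: "n \<in> {n. epoch g n \<le> t}" and "m \<le> n"
  then have "epoch g m \<le> epoch g n"
    using strict_mono_less_eq[OF strict_mono_epoch, of m n] by blast
  also have "\<dots> \<le> t" using n by simp
  finally show "m \<in> {n. epoch g n \<le> t}" by simp
qed

text \<open>If the epochs accumulate before \<open>t\<close>, \<open>epochs_until g t\<close> is the
  default 0 but every epoch is at most \<open>t\<close>, so the bound holds for all
  \<open>n\<close>.\<close>

lemma sum_gaps_le:
  assumes "0 \<le> t" and "finite {n. epoch g n \<le> t} \<Longrightarrow> n \<le> epochs_until g t"
  shows "(\<Sum>i<n. g !! i) \<le> t"
proof (cases n)
  case (Suc k)
  have "epoch g k \<le> t"
  proof (cases "finite {n. epoch g n \<le> t}")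
    case True
    then have "k \<in> {..<epochs_until g t}"
      using assms(2) Suc by simp
    then show ?thesis
      using epochs_until_finite[OF True] by blast
  next
    case False
    then obtain n where "k \<le> n" "epoch g n \<le> t"
      unfolding infinite_nat_iff_unbounded_le by blast
    then show ?thesis
      using strict_mono_less_eq[OF strict_mono_epoch, of k n] order_trans by blast
  qed
  then show ?thesis by (simp add: Suc epoch_def lessThan_Suc_atMost)
qed (simp add: assms)

end

context network
begin

text \<open>Gap \<open>i\<close> is counted if the first \<open>i\<close> events contain no return.
  All counted gaps have elapsed by any candidate time \<open>t\<close>, so the infimum is at least
  their sum.\<close>

lemma return_time_ge:
  assumes pos: "\<And>n. 0 < g !! n"
  shows "(\<Sum>i. ennreal (g !! i) * of_bool (\<not> returned x (stake i m))) \<le> return_time x (g, m)"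
  unfolding return_time_def
proof (rule INF_greatest)
  fix t assume "t \<in> {t. 0 \<le> t \<and> X_path x (g, m) t = x \<and> (\<exists>s. 0 \<le> s \<and> s < t \<and> X_path x (g, m) s \<noteq> x)}"
  then obtain s where t: "0 \<le> t" "X_path x (g, m) t = x"
    and s: "0 \<le> s" "s < t" "X_path x (g, m) s \<noteq> x"
    by blast
  let ?k = "epochs_until g t"
  \<comment> \<open>The path differs at \<open>s\<close> and \<open>t\<close>, so events occur in
    between: index \<open>?k\<close> is a visit to \<open>x\<close> after an earlier index
    elsewhere.\<close>
  have ret: "returned x (stake i m)" if fin: "finite {n. epoch g n \<le> t}" and i: "?k \<le> i" for i
  proof -
    have sub: "{n. epoch g n \<le> s} \<subseteq> {n. epoch g n \<le> t}" using s by auto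
    then have "epochs_until g s \<le> ?k"
      unfolding epochs_until_def by (rule card_mono[OF fin])
    moreover have "epochs_until g s \<noteq> ?k"
      using t s by (auto simp: X_path_def)
    ultimately have "epochs_until g s < ?k" by simp
    moreover have "fold act (take ?k (stake i m)) x = x"
      using t i by (simp add: take_stake X_path_def min_absorb1)
    moreover have "fold act (take (epochs_until g s) (stake i m)) x \<noteq> x"
      using s i \<open>epochs_until g s < ?k\<close> by (simp add: take_stake X_path_def min_absorb1)
    ultimately show ?thesis
      using i unfolding returned_def by (metis length_stake)
  qed
  have "(\<Sum>i<n. ennreal (g !! i) * of_bool (\<not> returned x (stake i m))) \<le> ennreal t" for n
  proof -
    define n' where "n' = (if finite {n. epoch g n \<le> t} then min n ?k else n)"
    have "(\<Sum>i<n. ennreal (g !! i) * of_bool (\<not> returned x (stake i m)))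
        = (\<Sum>i<n'. ennreal (g !! i) * of_bool (\<not> returned x (stake i m)))"
      using ret by (intro sum.mono_neutral_right) (auto simp: n'_def split: if_splits)
    also have "\<dots> \<le> (\<Sum>i<n'. ennreal (g !! i))"
      by (intro sum_mono) (auto simp: of_bool_def)
    also have "\<dots> = ennreal (\<Sum>i<n'. g !! i)"
      using pos by (intro sum_ennreal) (simp add: less_imp_le)
    also have "\<dots> \<le> ennreal t"
      using sum_gaps_le[of g t n', OF pos t(1)] by (intro ennreal_leI) (auto simp: n'_def)
    finally show ?thesis .
  qed
  then show "(\<Sum>i. ennreal (g !! i) * of_bool (\<not> returned x (stake i m))) \<le> ennreal t"
    unfolding suminf_eq_SUP by (intro SUP_least)
qed

text \<open>The epoch that completes the first return is a candidate time and equals the sum of the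
  counted gaps; \<open>ret\<close> ensures that it exists.\<close>

lemma return_time_le:
  assumes pos: "\<And>n. 0 < g !! n" and ret: "returned x (stake n m)"
  shows "return_time x (g, m) \<le> (\<Sum>i. ennreal (g !! i) * of_bool (\<not> returned x (stake i m)))"
proof -
  define R where "R = (LEAST n. returned x (stake n m))"
  have R: "returned x (stake R m)"
    unfolding R_def using ret by (rule LeastI)
  have before: "\<not> returned x (stake i m)" if "i < R" for i
    using that unfolding R_def by (rule not_less_Least)
  obtain j i where "j \<le> length (stake R m)" "i < j" "fold act (take j (stake R m)) x = x"
      "fold act (take i (stake R m)) x \<noteq> x"
    using R unfolding returned_def by blast
  then have ij: "j \<le> R" "i < j" "fold act (stake j m) x = x" "fold act (stake i m) x \<noteq> x"
    by (simp_all add: take_stake min_absorb1)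
  then have "j \<le> length (stake j m)" "fold act (take j (stake j m)) x = x"
      "fold act (take i (stake j m)) x \<noteq> x"
    by (simp_all add: take_stake min_absorb1)
  then have "returned x (stake j m)"
    unfolding returned_def using ij(2) by blast
  \<comment> \<open>The prefix of length \<open>j\<close> already contains a return, so minimality
    of \<open>R\<close> applies.\<close>
  then have j: "j = R"
    using before[of j] ij(1) by (meson le_neq_implies_less)
  obtain i' where i': "i = Suc i'" using ij(4) by (cases i) auto
  obtain j' where j': "j = Suc j'" using ij(2) by (cases j) auto
  \<comment> \<open>Epochs are numbered from 0: at \<open>epoch g j'\<close> exactly
    \<open>Suc j'\<close> events have occurred.\<close>
  have "X_path x (g, m) (epoch g j') = x" "X_path x (g, m) (epoch g i') \<noteq> x"
    using ij i' j' by (simp_all add: X_path_def epochs_until_epoch[OF pos])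
  moreover have "epoch g i' < epoch g j'"
    using strict_mono_less[OF strict_mono_epoch[OF pos]] ij i' j' by simp
  moreover have "0 \<le> epoch g i'" "0 \<le> epoch g j'"
    using epoch_pos[OF pos] by (simp_all add: less_imp_le)
  ultimately have "return_time x (g, m) \<le> ennreal (epoch g j')"
    unfolding return_time_def by (intro INF_lower) blast
  also have "\<dots> = ennreal (\<Sum>i<R. g !! i)"
  proof -
    have "R = Suc j'" using j j' by simp
    then show ?thesis by (simp add: epoch_def lessThan_Suc_atMost)
  qed
  also have "\<dots> = (\<Sum>i<R. ennreal (g !! i))"
    using pos by (intro sum_ennreal[symmetric]) (simp add: less_imp_le)
  also have "\<dots> = (\<Sum>i<R. ennreal (g !! i) * of_bool (\<not> returned x (stake i m)))"
    using before by simp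
  also have "\<dots> \<le> (\<Sum>i. ennreal (g !! i) * of_bool (\<not> returned x (stake i m)))"
    by (intro sum_le_suminf) auto
  finally show ?thesis .
qed

section \<open>Integration over gaps and marks\<close>

definition marks :: "'v event stream measure" where
  "marks = stream_space (measure_pmf (mark_pmf lam))"

definition gap :: "real measure" where
  "gap = density lborel (exponential_density (total_rate lam))"

lemma clock_space_eq: "clock_space lam = stream_space gap \<Otimes>\<^sub>M marks"
  by (simp add: clock_space_def marks_def gap_def)

lemma sets_marks [measurable_cong]: "sets marks = sets (stream_space (count_space UNIV))"
  unfolding marks_def by (intro sets_stream_space_cong) simp

lemma sets_gap [measurable_cong, simp]: "sets gap = sets borel"
  by (simp add: gap_def)

lemma prob_space_gap: "prob_space gap"
  unfolding gap_def by (intro prob_space_exponential_density total_rate_positive)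

lemma measurable_stake_marks [measurable]: "stake n \<in> measurable marks (count_space UNIV)"
  unfolding measurable_cong_sets[OF sets_marks refl] by (rule measurable_stake)

text \<open>Splitting off the first mark matches the recursion of \<open>mean\<close>.\<close>

lemma nn_integral_stake:
  assumes "\<And>es. 0 \<le> f es"
  shows "(\<integral>\<^sup>+m. ennreal (f (stake n m)) \<partial>marks) = ennreal (mean w n f)"
  using assms
proof (induction n arbitrary: f)
  case 0
  interpret prob_space marks
    unfolding marks_def by (intro prob_space.prob_space_stream_space prob_space_measure_pmf)
  show ?case by (simp add: emeasure_space_1)
next
  case (Suc n)
  have [measurable]: "(\<lambda>m. ennreal (f (stake (Suc n) m))) \<in> borel_measurable marks"
    by measurable
  have "(\<integral>\<^sup>+m. ennreal (f (stake (Suc n) m)) \<partial>marks)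
      = (\<integral>\<^sup>+e. (\<integral>\<^sup>+m. ennreal (f (e # stake n m)) \<partial>marks) \<partial>measure_pmf (mark_pmf lam))"
    unfolding marks_def
    by (subst prob_space.nn_integral_stream_space[OF prob_space_measure_pmf])
      (simp_all flip: marks_def)
  also have "\<dots> = (\<integral>\<^sup>+e. ennreal (mean w n (\<lambda>es. f (e # es))) \<partial>measure_pmf (mark_pmf lam))"
    by (intro nn_integral_cong Suc.IH Suc.prems)
  also have "\<dots> = (\<Sum>e\<in>UNIV. ennreal (w e) * ennreal (mean w n (\<lambda>es. f (e # es))))"
    by (simp add: nn_integral_measure_pmf nn_integral_count_space_finite w_def
        pmf_mark_pmf two_nodes lam_nonneg)
  also have "\<dots> = (\<Sum>e\<in>UNIV. ennreal (w e * mean w n (\<lambda>es. f (e # es))))"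
    by (simp add: ennreal_mult w_nonneg mean_nonneg Suc.prems)
  also have "\<dots> = ennreal (mean w (Suc n) f)"
    by (simp add: w_nonneg mean_nonneg Suc.prems)
  finally show ?case .
qed

lemma nn_integral_snth_gap:
  assumes [measurable]: "h \<in> borel_measurable borel"
  shows "(\<integral>\<^sup>+g. h (g !! i) \<partial>stream_space gap) = (\<integral>\<^sup>+y. h y \<partial>gap)"
proof -
  interpret gap: prob_space gap by (rule prob_space_gap)
  interpret gaps: prob_space "stream_space gap" by (rule gap.prob_space_stream_space)
  show ?thesis
  proof (induction i)
    case 0
    show ?case
      by (subst gap.nn_integral_stream_space) (simp_all add: gaps.emeasure_space_1)
  next
    case (Suc i)
    show ?case
      by (subst gap.nn_integral_stream_space) (simp_all add: Suc gap.emeasure_space_1)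
  qed
qed

text \<open>Gap \<open>i\<close> is independent of the first \<open>i\<close> marks, so each term
  factors, as in Wald's identity. It is used with the gap length for \<open>h\<close> and with the
  constant 1, which counts events.\<close>

lemma nn_integral_clock_space:
  assumes [measurable]: "h \<in> borel_measurable borel"
  shows "(\<integral>\<^sup>+\<omega>. (\<Sum>i. h (fst \<omega> !! i) * of_bool (\<not> returned x (stake i (snd \<omega>)))) \<partial>clock_space lam)
    = (\<integral>\<^sup>+y. h y \<partial>gap) * (\<Sum>i. ennreal (away x i))"
proof -
  interpret gap: prob_space gap by (rule prob_space_gap)
  interpret marks: prob_space marks
    unfolding marks_def by (intro prob_space.prob_space_stream_space prob_space_measure_pmf)
  have nb [measurable]: "(\<lambda>m. of_bool (\<not> returned x (stake i m)) :: ennreal) \<in> borel_measurable marks" for i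
    by measurable
  have "(\<integral>\<^sup>+\<omega>. (\<Sum>i. h (fst \<omega> !! i) * of_bool (\<not> returned x (stake i (snd \<omega>)))) \<partial>clock_space lam)
      = (\<Sum>i. \<integral>\<^sup>+\<omega>. h (fst \<omega> !! i) * of_bool (\<not> returned x (stake i (snd \<omega>))) \<partial>clock_space lam)"
    unfolding clock_space_eq by (intro nn_integral_suminf) measurable
  also have "\<dots> = (\<Sum>i. (\<integral>\<^sup>+y. h y \<partial>gap) * ennreal (away x i))"
  proof (rule suminf_cong)
    fix i
    have "(\<integral>\<^sup>+\<omega>. h (fst \<omega> !! i) * of_bool (\<not> returned x (stake i (snd \<omega>))) \<partial>clock_space lam)
        = (\<integral>\<^sup>+g. \<integral>\<^sup>+m. h (g !! i) * of_bool (\<not> returned x (stake i m)) \<partial>marks \<partial>stream_space gap)"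
      unfolding clock_space_eq by (subst marks.nn_integral_fst[symmetric]) simp_all
    also have "\<dots> = (\<integral>\<^sup>+g. h (g !! i) * (\<integral>\<^sup>+m. of_bool (\<not> returned x (stake i m)) \<partial>marks) \<partial>stream_space gap)"
      by (intro nn_integral_cong nn_integral_cmult nb)
    also have "(\<integral>\<^sup>+m. of_bool (\<not> returned x (stake i m)) \<partial>marks) = ennreal (away x i)"
    proof -
      have "ennreal (of_bool P) = of_bool P" for P by (cases P) auto
      then show ?thesis
        using nn_integral_stake[of "\<lambda>es. of_bool (\<not> returned x es)" i] by (simp add: away_def)
    qed
    also have "(\<integral>\<^sup>+g. h (g !! i) * ennreal (away x i) \<partial>stream_space gap)
        = (\<integral>\<^sup>+g. h (g !! i) \<partial>stream_space gap) * ennreal (away x i)"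
      by (intro nn_integral_multc) measurable
    also have "(\<integral>\<^sup>+g. h (g !! i) \<partial>stream_space gap) = (\<integral>\<^sup>+y. h y \<partial>gap)"
      by (rule nn_integral_snth_gap) measurable
    finally show "(\<integral>\<^sup>+\<omega>. h (fst \<omega> !! i) * of_bool (\<not> returned x (stake i (snd \<omega>))) \<partial>clock_space lam)
        = (\<integral>\<^sup>+y. h y \<partial>gap) * ennreal (away x i)" .
  qed
  also have "\<dots> = (\<integral>\<^sup>+y. h y \<partial>gap) * (\<Sum>i. ennreal (away x i))"
    by simp
  finally show ?thesis .
qed

lemma mean_gap: "(\<integral>\<^sup>+y. ennreal y \<partial>gap) = ennreal s"
proof -
  have "(\<integral>\<^sup>+y. ennreal y \<partial>gap)
      = (\<integral>\<^sup>+y. ennreal (exponential_density (total_rate lam) y) * ennreal y \<partial>lborel)"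
    unfolding gap_def by (rule nn_integral_density) simp_all
  also have "\<dots> = (\<integral>\<^sup>+y. ennreal (exponential_density (total_rate lam) y * y ^ 1) \<partial>lborel)"
    using total_rate_positive by (intro nn_integral_cong) (simp add: ennreal_mult' exponential_density_nonneg)
  \<comment> \<open>The exponential density is the Erlang density of index 0; this is its first
    moment.\<close>
  also have "\<dots> = fact (0 + 1) / (fact 0 * total_rate lam ^ 1)"
    by (rule nn_integral_erlang_ith_moment[OF total_rate_positive])
  finally show ?thesis by (simp add: s_def)
qed

lemma AE_gaps_pos: "AE \<omega> in clock_space lam. \<forall>n. 0 < fst \<omega> !! n"
proof -
  interpret gap: prob_space gap by (rule prob_space_gap)
  interpret gaps: prob_space "stream_space gap" by (rule gap.prob_space_stream_space)
  interpret marks: prob_space marks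
    unfolding marks_def by (intro prob_space.prob_space_stream_space prob_space_measure_pmf)
  interpret pair_prob_space "stream_space gap" marks ..
  have "AE y in gap. 0 < y"
    unfolding gap_def using AE_lborel_singleton[of 0]
    by (subst AE_density) (auto simp: exponential_density_def elim!: eventually_mono)
  then have "AE g in stream_space gap. \<forall>n. 0 < g !! n"
    using gap.AE_stream_all[of "\<lambda>y. 0 < y"] unfolding stream_all_def by simp
  then show ?thesis
    unfolding clock_space_eq
    by (subst AE_pair_iff[symmetric]) auto
qed

lemma return_time_finite:
  assumes "summable (away x)"
  shows "(\<integral>\<^sup>+\<omega>. return_time x \<omega> \<partial>clock_space lam) < \<infinity>"
proof -
  interpret gap: prob_space gap by (rule prob_space_gap)
  have fin: "(\<Sum>i. ennreal (away x i)) \<noteq> \<infinity>"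
    using suminf_ennreal2[OF away_nonneg assms] by simp
  \<comment> \<open>Weight 1 gives a finite mean number of events, so a return occurs almost surely,
    as \<open>return_time_le\<close> requires.\<close>
  have "(\<integral>\<^sup>+\<omega>. (\<Sum>i. (\<lambda>_. 1) (fst \<omega> !! i) * of_bool (\<not> returned x (stake i (snd \<omega>)))) \<partial>clock_space lam) \<noteq> \<infinity>"
    by (subst nn_integral_clock_space) (use fin in \<open>simp_all add: gap.emeasure_space_1\<close>)
  then have "AE \<omega> in clock_space lam. (\<Sum>i. 1 * of_bool (\<not> returned x (stake i (snd \<omega>))) :: ennreal) \<noteq> \<infinity>"
    unfolding clock_space_eq by (intro nn_integral_noteq_infinite) measurable
  then have ret: "AE \<omega> in clock_space lam. \<exists>n. returned x (stake n (snd \<omega>))"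
  proof eventually_elim
    case (elim \<omega>)
    have "(\<Sum>i. 1 :: ennreal) = \<infinity>"
      by (simp add: suminf_eq_SUP ennreal_SUP_of_nat_eq_top)
    moreover have "(\<Sum>i. 1 * of_bool (\<not> returned x (stake i (snd \<omega>))) :: ennreal) = (\<Sum>i. 1)"
      if "\<not> (\<exists>n. returned x (stake n (snd \<omega>)))"
      using that by (intro suminf_cong) simp
    ultimately show ?case
      using elim by metis
  qed
  have "(\<integral>\<^sup>+\<omega>. return_time x \<omega> \<partial>clock_space lam)
      \<le> (\<integral>\<^sup>+\<omega>. (\<Sum>i. ennreal (fst \<omega> !! i) * of_bool (\<not> returned x (stake i (snd \<omega>)))) \<partial>clock_space lam)"
  \<comment> \<open>The integral is monotone for arbitrary functions, so comparison with the series
    settles \<open>return_time\<close> without a measurability proof.\<close>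
  proof (rule nn_integral_mono_AE)
    show "AE \<omega> in clock_space lam. return_time x \<omega>
        \<le> (\<Sum>i. ennreal (fst \<omega> !! i) * of_bool (\<not> returned x (stake i (snd \<omega>))))"
      using AE_gaps_pos ret
    proof eventually_elim
      case (elim \<omega>)
      then obtain n where "returned x (stake n (snd \<omega>))" by blast
      with elim(1) show ?case
        using return_time_le[of "fst \<omega>" x n "snd \<omega>"] by simp
    qed
  qed
  also have "\<dots> = ennreal s * (\<Sum>i. ennreal (away x i))"
    by (subst nn_integral_clock_space) (simp_all add: mean_gap)
  also have "\<dots> < \<infinity>"
    using fin by (simp add: ennreal_mult_less_top less_top)
  finally show ?thesis .
qed

text \<open>The series is a lower bound for every positive gap sequence, whether or not the chain
  returns, so its infinite mean is inherited.\<close>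

lemma return_time_infinite:
  assumes "\<not> summable (away x)"
  shows "(\<integral>\<^sup>+\<omega>. return_time x \<omega> \<partial>clock_space lam) = \<infinity>"
proof -
  have "(\<Sum>i. ennreal (away x i)) = \<infinity>"
  proof (rule ccontr)
    assume "(\<Sum>i. ennreal (away x i)) \<noteq> \<infinity>"
    then have "summable (away x)"
      by (intro summable_suminf_not_top[OF away_nonneg]) simp
    with assms show False by contradiction
  qed
  then have "\<infinity> = ennreal s * (\<Sum>i. ennreal (away x i))"
    using s_pos by (simp add: ennreal_mult_top)
  also have "\<dots> = (\<integral>\<^sup>+\<omega>. (\<Sum>i. ennreal (fst \<omega> !! i) * of_bool (\<not> returned x (stake i (snd \<omega>)))) \<partial>clock_space lam)"
    by (subst nn_integral_clock_space) (simp_all add: mean_gap)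
  also have "\<dots> \<le> (\<integral>\<^sup>+\<omega>. return_time x \<omega> \<partial>clock_space lam)"
  proof (rule nn_integral_mono_AE)
    show "AE \<omega> in clock_space lam. (\<Sum>i. ennreal (fst \<omega> !! i) * of_bool (\<not> returned x (stake i (snd \<omega>))))
        \<le> return_time x \<omega>"
      using AE_gaps_pos
    proof eventually_elim
      case (elim \<omega>)
      then show ?case
        using return_time_ge[of "fst \<omega>" x "snd \<omega>"] by simp
    qed
  qed
  finally show ?thesis by (simp add: top_unique)
qed

section \<open>Stability below load one, instability from load one on\<close>

lemma stable:
  assumes "\<And>u. lam u < 1"
  shows "stable_network lam"
  unfolding stable_network_def positive_recurrent_def
proof
  fix x assume x: "x \<in> reachable lam"
  show "absorbing lam x \<or> (\<integral>\<^sup>+\<omega>. return_time x \<omega> \<partial>clock_space lam) < \<infinity>"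
  proof (cases "absorbing lam x")
    case False
    then obtain B where B: "\<And>T. (\<Sum>j<T. away x j) \<le> B"
      using sum_away_bounded[OF assms x] by blast
    then have "summable (away x)"
      by (rule summableI_nonneg_bounded[OF away_nonneg])
    then show ?thesis
      using return_time_finite by blast
  qed simp
qed

lemma unstable:
  assumes l: "\<And>u. lam u = l" "1 \<le> l"
  shows "\<not> stable_network lam"
proof
  assume "stable_network lam"
  then have "positive_recurrent lam empty_state"
    by (simp add: stable_network_def reachable.empty)
  \<comment> \<open>An absorbing state would count as positive recurrent; here arrivals have
    positive rate and change the empty state.\<close>
  moreover have "\<not> absorbing lam empty_state"
  proof
    assume "absorbing lam empty_state"
    then have "arrive u (empty_state :: 'v state) = empty_state" for u
      using l by (auto simp: absorbing_def rate_def dest: spec[of _ "Inl u"])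
    then show False
      using backlog_arrive[OF two_nodes consistent_empty] two_nodes by (simp add: backlog_empty)
  qed
  ultimately show False
    using return_time_infinite[OF not_summable_away[OF l]] by (simp add: positive_recurrent_def)
qed

end

theorem theorem4p2:
  fixes lam :: "'v::finite \<Rightarrow> real"
  assumes "2 \<le> CARD('v)"
    and "\<And>u. 0 \<le> lam u"
  shows "((\<forall>u. lam u < 1) \<longrightarrow> stable_network lam) \<and>
    (\<forall>l. (\<forall>u. lam u = l) \<longrightarrow> (stable_network lam \<longleftrightarrow> l < 1))"
proof -
  interpret network lam
    using assms by unfold_locales
  show ?thesis
  proof (intro conjI allI impI)
    show "stable_network lam" if "\<forall>u. lam u < 1"
      using that by (intro stable) blast
    show "stable_network lam \<longleftrightarrow> l < 1" if l: "\<forall>u. lam u = l" for l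
    proof
      show "stable_network lam" if "l < 1"
        using that l by (intro stable) simp
      show "l < 1" if "stable_network lam"
        using that unstable[of l] l by (meson linorder_not_less)
    qed
  qed
qed

end
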